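(* Let $n\in\mathbb{N}$, let $\alpha$ be a composition of $n$ and let $T$ be a linear extension of $D(\alpha)$. Then the number of $\pi\in S_n'$ with $\alpha_\pi=\alpha$ and $T_\pi=T$ equals \[\prod_{(i,j)\in D(\alpha)}h_\alpha(i,j).\]
   Context: A "permutation" may be any finite sequence of distinct integers. West's stack-sorting map $s$: read the input left to right with an initially empty stack; repeatedly, if the input is nonempty and either the stack is empty or the top of the stack is greater than the next input entry, push the next entry; otherwise pop the top of the stack and append it to the output; stop when input and stack are empty. $\operatorname{sc}(\pi)$ is the least $k\ge0$ with $s^k(\pi)$ increasing. $S_n'$ is the set of permutations of $\{0,1,\dots,n\}$ whose last entry is $0$. For $\pi\in S_n'$ and $1\le i\le\operatorname{sc}(\pi)$ let $\sigma=s^{i-1}(\pi)$. Let $c_{\pi,i,1}$ be the maximum of the entries of $\sigma$ strictly left of $0$; for $j\ge2$, as long as some entry of $\sigma$ lies strictly between $c_{\pi,i,j-1}$ and $0$, let $c_{\pi,i,j}$ be the maximum of those entries; otherwise stop. This gives $C_{\pi,i}=(c_{\pi,i,1},\dots,c_{\pi,i,|C_{\pi,i}|})$. Blocks: $b_{\pi,i,1}$ is the contiguous subsequence of $\sigma$ strictly before $c_{\pi,i,1}$, and $b_{\pi,i,j}$ ($j\ge2$) the contiguous subsequence strictly between $c_{\pi,i,j-1}$ and $c_{\pi,i,j}$. Every $x\in[n]$ equals $c_{\pi,i,j}$ for a unique pair $(i,j)$; set $\operatorname{col}_\pi(x)=i$, $\operatorname{colpos}_\pi(x)=j$. If $\operatorname{col}_\pi(x)>1$,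 there is a unique $j$ with $x=\max(b_{\pi,\operatorname{col}_\pi(x)-1,j})$, and $\operatorname{leftof}_\pi(x):=c_{\pi,\operatorname{col}_\pi(x)-1,j}$. Recursively $\operatorname{row}_\pi(x)=\operatorname{colpos}_\pi(x)$ if $\operatorname{col}_\pi(x)=1$, and $\operatorname{row}_\pi(x)=\operatorname{row}_\pi(\operatorname{leftof}_\pi(x))$ otherwise. The composition $\alpha_\pi=(|\{x\in[n]:\operatorname{row}_\pi(x)=j\}|)_{j=1}^{|C_{\pi,1}|}$. For a composition $\alpha=(\alpha_1,\dots,\alpha_m)$ of $n$, $D(\alpha)=\{(i,j)\in\mathbb{N}^2: 1\le j\le m,\ i\le\alpha_j\}$, with partial order $(a,b)\ge_D(c,d)$ iff $a\le c$ and $b\le d$. $T_\pi:[n]\to D(\alpha_\pi)$, $T_\pi(x)=(\operatorname{col}_\pi(x),\operatorname{row}_\pi(x))$. A linear extension of $D(\alpha)$ is a bijection $T:[n]\to D(\alpha)$ such that $T(x)\ge_D T(y)$ implies $x\ge y$. Hook length: $h_\alpha(1,j)=1$; for $i>1$, letting $r=\max\{j'<j:\alpha_{j'}\ge i-1\}$ (with $r=0$ if the set is empty), $h_\alpha(i,j)=|\{(i',j')\in D(\alpha): i'\le i-1,\ r<j'\le j\}|$. *)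

theory Defs
  imports Main "HOL-Combinatorics.Multiset_Permutations"
begin

text \<open>
  West's stack-sorting map. The first argument is the stack (top first), the second the remaining
  input; popped entries are emitted in order, so the result is the output.
\<close>

function stack_run :: "'a::linorder list \<Rightarrow> 'a list \<Rightarrow> 'a list" where
  "stack_run [] [] = []"
| "stack_run [] (x # xs) = stack_run [x] xs"
| "stack_run (t # st) [] = t # stack_run st []"
| "stack_run (t # st) (x # xs) =
     (if t > x then stack_run (x # t # st) xs else t # stack_run st (x # xs))"
  by pat_completeness auto
termination
  by (relation "measure (\<lambda>(st, xs). length st + 2 * length xs)") auto

definition stack_sort :: "'a::linorder list \<Rightarrow> 'a list" where
  "stack_sort xs = stack_run [] xs"

definition sc :: "'a::linorder list \<Rightarrow> nat" where
  "sc xs = (LEAST k. sorted_wrt (<) ((stack_sort ^^ k) xs))"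

definition S' :: "nat \<Rightarrow> nat list set" where
  "S' n = {\<pi> \<in> permutations_of_set {0..n}. last \<pi> = 0}"

definition before :: "'a \<Rightarrow> 'a list \<Rightarrow> 'a list" where
  "before x xs = takeWhile (\<lambda>y. y \<noteq> x) xs"

definition after :: "'a \<Rightarrow> 'a list \<Rightarrow> 'a list" where
  "after x xs = tl (dropWhile (\<lambda>y. y \<noteq> x) xs)"

lemma length_after_less: "xs \<noteq> [] \<Longrightarrow> length (after x xs) < length xs"
proof -
  assume "xs \<noteq> []"
  moreover have "length (dropWhile (\<lambda>y. y \<noteq> x) xs) \<le> length xs"
    by (rule length_dropWhile_le)
  moreover have "length xs > 0"
    using \<open>xs \<noteq> []\<close> by simp
  ultimately show ?thesis
    unfolding after_def length_tl by linarith
qed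

function champions :: "nat list \<Rightarrow> nat list" where
  "champions xs =
     (if xs = [] then [] else Max (set xs) # champions (after (Max (set xs)) xs))"
  by pat_completeness auto
termination
  by (relation "measure length") (auto simp: length_after_less)

declare champions.simps [simp del]

text \<open>
  All positions, columns and rows below are counted from 1, whereas list access is 0-based.
\<close>

definition sigma :: "nat list \<Rightarrow> nat \<Rightarrow> nat list" where
  "sigma \<pi> i = (stack_sort ^^ (i - 1)) \<pi>"

definition C_seq :: "nat list \<Rightarrow> nat \<Rightarrow> nat list" where
  "C_seq \<pi> i = champions (before 0 (sigma \<pi> i))"

definition c_entry :: "nat list \<Rightarrow> nat \<Rightarrow> nat \<Rightarrow> nat" where
  "c_entry \<pi> i j = C_seq \<pi> i ! (j - 1)"

definition block :: "nat list \<Rightarrow> nat \<Rightarrow> nat \<Rightarrow> nat list" where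
  "block \<pi> i j =
     (if j = 1 then before (c_entry \<pi> i 1) (sigma \<pi> i)
      else before (c_entry \<pi> i j) (after (c_entry \<pi> i (j - 1)) (sigma \<pi> i)))"

definition coords :: "nat list \<Rightarrow> nat \<Rightarrow> nat \<times> nat" where
  "coords \<pi> x =
     (THE (i, j). i \<in> {1..sc \<pi>} \<and> j \<in> {1..length (C_seq \<pi> i)} \<and> x = c_entry \<pi> i j)"

definition col :: "nat list \<Rightarrow> nat \<Rightarrow> nat" where
  "col \<pi> x = fst (coords \<pi> x)"

definition colpos :: "nat list \<Rightarrow> nat \<Rightarrow> nat" where
  "colpos \<pi> x = snd (coords \<pi> x)"

definition leftof :: "nat list \<Rightarrow> nat \<Rightarrow> nat" where
  "leftof \<pi> x =
     (let i = col \<pi> x - 1 in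
      c_entry \<pi> i (THE j. j \<in> {1..length (C_seq \<pi> i)} \<and>
                     block \<pi> i j \<noteq> [] \<and> x = Max (set (block \<pi> i j))))"

partial_function (tailrec) row :: "nat list \<Rightarrow> nat \<Rightarrow> nat" where
  "row \<pi> x = (if col \<pi> x = 1 then colpos \<pi> x else row \<pi> (leftof \<pi> x))"

text \<open>
  For \<open>\<pi>\<close> in \<open>S' n\<close> we have \<open>length \<pi> - 1 = n\<close>.
\<close>

definition alpha :: "nat list \<Rightarrow> nat list" where
  "alpha \<pi> =
     map (\<lambda>j. card {x \<in> {1..length \<pi> - 1}. row \<pi> x = j}) [1..<length (C_seq \<pi> 1) + 1]"

definition T_of :: "nat list \<Rightarrow> nat \<Rightarrow> nat \<times> nat" where
  "T_of \<pi> x = (col \<pi> x, row \<pi> x)"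

definition composition_of :: "nat list \<Rightarrow> nat \<Rightarrow> bool" where
  "composition_of \<alpha> n \<longleftrightarrow> (\<forall>a \<in> set \<alpha>. a \<ge> 1) \<and> sum_list \<alpha> = n"

definition diagram :: "nat list \<Rightarrow> (nat \<times> nat) set" where
  "diagram \<alpha> = {(i, j). 1 \<le> j \<and> j \<le> length \<alpha> \<and> 1 \<le> i \<and> i \<le> \<alpha> ! (j - 1)}"

definition ge_D :: "nat \<times> nat \<Rightarrow> nat \<times> nat \<Rightarrow> bool" where
  "ge_D p q \<longleftrightarrow> fst p \<le> fst q \<and> snd p \<le> snd q"

definition linear_extension :: "nat \<Rightarrow> nat list \<Rightarrow> (nat \<Rightarrow> nat \<times> nat) \<Rightarrow> bool" where
  "linear_extension n \<alpha> T \<longleftrightarrow>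
     bij_betw T {1..n} (diagram \<alpha>) \<and>
     (\<forall>x \<in> {1..n}. \<forall>y \<in> {1..n}. ge_D (T x) (T y) \<longrightarrow> x \<ge> y)"

definition hook_bound :: "nat list \<Rightarrow> nat \<Rightarrow> nat \<Rightarrow> nat" where
  "hook_bound \<alpha> i j =
     (let R = {j'. 1 \<le> j' \<and> j' < j \<and> \<alpha> ! (j' - 1) \<ge> i - 1}
      in if R = {} then 0 else Max R)"

definition hook :: "nat list \<Rightarrow> nat \<Rightarrow> nat \<Rightarrow> nat" where
  "hook \<alpha> i j =
     (if i = 1 then 1
      else card {(i', j') \<in> diagram \<alpha>. i' \<le> i - 1 \<and> hook_bound \<alpha> i j < j' \<and> j' \<le> j})"

end

theory Submission
  imports Defs
begin

text \<open>
  West's map is determined by its effect on pairs: for \<open>a < b\<close>, the entry \<open>b\<close> precedes \<open>a\<close> in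
  \<open>s(w)\<close> iff some \<open>c > b\<close> lies between \<open>b\<close> and \<open>a\<close> in \<open>w\<close>. Hence deleting the least positive entry
  \<open>z\<close> of a word ending in \<open>0\<close> changes neither the relative order of the other entries in any iterate
  nor their cells, and one counts words by inserting the positive entries in decreasing order.

  Let \<open>z\<close> be inserted directly in front of \<open>y\<close>. When an entry moves from a block of one row to a
  block of a later row, all rows passed over have just ended and are shorter than the new one.
  So the row in which \<open>z\<close> ends is the first row, from the row of \<open>y\<close> on, that is at least as
  long as all later rows. The insertions placing \<open>z\<close> in a given cell therefore correspond to the
  cells counted by the hook of that cell, and deleting \<open>z\<close> does not affect the other hooks.
\<close>

section \<open>Precedence in words and the stack-sorting map\<close>

text \<open>On a distinct word this is the strict linear order of positions. Words are studied
  through it from here on, because West's map changes it by a rule on pairs.\<close>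

fun prec :: "'a list \<Rightarrow> 'a \<Rightarrow> 'a \<Rightarrow> bool" where
  "prec [] x y \<longleftrightarrow> False"
| "prec (h # t) x y \<longleftrightarrow> x = h \<and> y \<in> set t \<or> prec t x y"

lemma prec_append:
  "prec (us @ vs) x y \<longleftrightarrow> prec us x y \<or> prec vs x y \<or> x \<in> set us \<and> y \<in> set vs"
  by (induction us) auto

lemma prec_in_set: "prec w x y \<Longrightarrow> x \<in> set w \<and> y \<in> set w"
  by (induction w) auto

lemma prec_irrefl: "distinct w \<Longrightarrow> \<not> prec w x x"
  by (induction w) auto

lemma prec_trans: "distinct w \<Longrightarrow> prec w x y \<Longrightarrow> prec w y z \<Longrightarrow> prec w x z"
  by (induction w) (auto dest: prec_in_set)

lemma prec_total: "x \<in> set w \<Longrightarrow> y \<in> set w \<Longrightarrow> x \<noteq> y \<Longrightarrow> prec w x y \<or> prec w y x"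
  by (induction w) auto

lemma prec_last: "distinct w \<Longrightarrow> w \<noteq> [] \<Longrightarrow> x \<in> set w \<Longrightarrow> x \<noteq> last w \<Longrightarrow> prec w x (last w)"
  by (induction w) (auto split: if_splits)

lemma prec_remove:
  "x \<noteq> z \<Longrightarrow> y \<noteq> z \<Longrightarrow> prec (us @ z # vs) x y \<longleftrightarrow> prec (us @ vs) x y"
  by (auto simp: prec_append)

lemma prec_rev: "prec (rev w) x y \<longleftrightarrow> prec w y x"
  by (induction w) (auto simp: prec_append dest: prec_in_set)

lemma sorted_wrt_prec: "sorted_wrt P w \<longleftrightarrow> (\<forall>x y. prec w x y \<longrightarrow> P x y)"
  by (induction w) (auto dest: prec_in_set)

lemma before_after_split: "c \<notin> set us \<Longrightarrow> before c (us @ c # vs) = us \<and> after c (us @ c # vs) = vs"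
  unfolding before_def after_def by (induction us) auto

lemma prec_split_iff:
  assumes "distinct (us @ c # vs)"
  shows "prec (us @ c # vs) x c \<longleftrightarrow> x \<in> set us" "prec (us @ c # vs) c x \<longleftrightarrow> x \<in> set vs"
  using assms prec_in_set[of us x c] prec_in_set[of vs x c] prec_in_set[of us c x] prec_in_set[of vs c x]
  by (auto simp: prec_append)

lemma set_before:
  assumes "distinct w" "c \<in> set w"
  shows "set (before c w) = {y. prec w y c}"
proof -
  obtain us vs where w: "w = us @ c # vs" "c \<notin> set us" using split_list_first assms(2) by metis
  show ?thesis
    unfolding w(1) prec_split_iff(1)[OF assms(1)[unfolded w(1)]] before_after_split[OF w(2), THEN conjunct1]
    by simp
qed

lemma prec_before:
  assumes "distinct w" "c \<in> set w"
  shows "prec (before c w) x y \<longleftrightarrow> prec w x y \<and> prec w y c"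
proof -
  obtain us vs where w: "w = us @ c # vs" "c \<notin> set us" using split_list_first assms(2) by metis
  then have "set us \<inter> set (c # vs) = {}" using assms(1) by auto
  then show ?thesis
    unfolding prec_split_iff[OF assms(1)[unfolded w(1)], folded w(1)]
    using w prec_in_set[of us x y] prec_in_set[of "c # vs" x y]
    by (auto simp: before_after_split prec_append)
qed

lemma after_notin: "c \<notin> set w \<Longrightarrow> after c w = []"
  unfolding after_def by (induction w) auto

lemma set_after:
  assumes "distinct w"
  shows "set (after c w) = {y. prec w c y}"
proof (cases "c \<in> set w")
  case True
  then obtain us vs where w: "w = us @ c # vs" "c \<notin> set us" using split_list_first by metis
  show ?thesis
    unfolding w(1) prec_split_iff(2)[OF assms[unfolded w(1)]] before_after_split[OF w(2), THEN conjunct2]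
    by simp
next
  case False
  then show ?thesis by (auto simp: after_notin dest: prec_in_set)
qed

lemma prec_after:
  assumes "distinct w"
  shows "prec (after c w) x y \<longleftrightarrow> prec w x y \<and> prec w c x"
proof (cases "c \<in> set w")
  case True
  then obtain us vs where w: "w = us @ c # vs" "c \<notin> set us" using split_list_first by metis
  then have "set us \<inter> set (c # vs) = {}" "c \<notin> set vs" using assms by auto
  then show ?thesis
    unfolding prec_split_iff(2)[OF assms[unfolded w(1)], folded w(1)]
    using w prec_in_set[of us x y] prec_in_set[of vs x y]
    by (auto simp: before_after_split prec_append)
next
  case False
  then show ?thesis by (auto simp: after_notin dest: prec_in_set)
qed

lemma distinct_before: "distinct w \<Longrightarrow> distinct (before c w)"
  unfolding before_def by simp

lemma distinct_after: "distinct w \<Longrightarrow> distinct (after c w)"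
  unfolding after_def by (simp add: distinct_tl)

section \<open>The effect of the stack on precedence\<close>

lemma mset_stack_run: "mset (stack_run st xs) = mset st + mset xs"
  by (induction st xs rule: stack_run.induct) auto

lemma set_stack_run: "set (stack_run st xs) = set st \<union> set xs"
  using arg_cong[OF mset_stack_run, of set_mset st xs] by simp

lemma distinct_stack_run: "distinct (stack_run st xs) \<longleftrightarrow> distinct (st @ xs)"
  by (rule mset_eq_imp_distinct_iff) (simp add: mset_stack_run)

text \<open>\<open>rev st @ xs\<close> is the word of the letters not yet output, in input order,
  because a stack is filled from the bottom. Pushing leaves this word as it is and popping deletes
  one letter, so the rule on pairs passes through the recursion.\<close>

lemma prec_stack_run:
  fixes a b :: "'a::linorder"
  assumes "sorted_wrt (<) st" "distinct (st @ xs)" "a < b"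
  shows "prec (stack_run st xs) b a \<longleftrightarrow>
    (\<exists>c>b. prec (rev st @ xs) b c \<and> prec (rev st @ xs) c a)"
  using assms
proof (induction st xs rule: stack_run.induct)
  \<comment> \<open>With the input exhausted both sides are false: the stack comes out in increasing
    order, and its reverse is decreasing, so no larger \<open>c\<close> follows
    \<open>b\<close>.\<close>
  case (3 t st)
  have "\<not> prec (rev (t # st)) c a" if "prec (rev (t # st)) b c" "c > b" for c
    using that "3.prems"(1) unfolding prec_rev sorted_wrt_prec by fastforce
  moreover have "\<not> prec (stack_run (t # st) []) b a"
  proof
    assume "prec (stack_run (t # st) []) b a"
    then consider "b = t" "a \<in> set st" | "prec (stack_run st []) b a"
      by (auto simp: set_stack_run)
    then show False
    proof cases
      case 1
      then show ?thesis using "3.prems"(1,3) by auto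
    next
      case 2
      then obtain c where "c > b" "prec st c b"
        using 3 by (auto simp: prec_rev)
      then show ?thesis using "3.prems"(1) unfolding sorted_wrt_prec by fastforce
    qed
  qed
  ultimately show ?case by auto
next
  case (4 t st x xs)
  show ?case
  proof (cases "t > x")
    case True
    then have "sorted_wrt (<) (x # t # st)" using "4.prems"(1) by auto
    moreover have "distinct ((x # t # st) @ xs)" using "4.prems"(2) by auto
    ultimately show ?thesis using "4.IH"(1)[OF True] "4.prems"(3) True by simp
  next
    case False
    then have tx: "t < x" using "4.prems" by auto
    have IH: "prec (stack_run st (x # xs)) b a \<longleftrightarrow>
      (\<exists>c>b. prec (rev st @ x # xs) b c \<and> prec (rev st @ x # xs) c a)"
      using 4 False by auto
    have st: "\<And>u. u \<in> set st \<Longrightarrow> t < u" and srt: "\<And>u v. prec st u v \<Longrightarrow> u < v"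
      using "4.prems"(1) by (auto simp: sorted_wrt_prec)
    have nt: "t \<notin> set st" "t \<notin> set xs" and d: "distinct st" "distinct xs" "set st \<inter> set xs = {}"
      "x \<notin> set st" "x \<notin> set xs"
      using "4.prems" by auto
    \<comment> \<open>If \<open>t\<close> is \<open>a\<close>, nothing is output before it, and the
      letters in front of it decrease. If \<open>t\<close> is \<open>b\<close>, the letter
      \<open>x\<close> that forces the pop is the witness for every smaller letter behind. Otherwise
      \<open>t\<close> cannot be the witness \<open>c\<close>, since the letters in front of it all
      exceed it.\<close>
    consider "a = t" | "b = t" | "a \<noteq> t" "b \<noteq> t" by blast
    then show ?thesis
    proof cases
      case 1
      have "\<not> prec (stack_run (t # st) (x # xs)) b a"
        using 1 False tx nt "4.prems"(3) by (auto simp: set_stack_run dest!: prec_in_set)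
      moreover have "\<not> prec (rev (t # st) @ x # xs) c a"
        if "c > b" "prec (rev (t # st) @ x # xs) b c" for c
      proof
        assume "prec (rev (t # st) @ x # xs) c a"
        then have "c \<in> set st"
          using 1 nt tx by (auto simp: prec_append dest: prec_in_set)
        then have "prec st c b"
          using that(2) nt d by (auto simp: prec_append prec_rev dest: prec_in_set)
        then show False using srt that(1) by fastforce
      qed
      ultimately show ?thesis by blast
    next
      case 2
      show ?thesis
      proof (cases "prec (rev (t # st) @ x # xs) t a")
        case True
        then have "a \<in> set xs" using nt tx 2 "4.prems"(3)
          by (auto simp: prec_append prec_rev dest: prec_in_set)
        then have "prec (stack_run (t # st) (x # xs)) b a"
          using False 2 by (simp add: set_stack_run)
        moreover have "prec (rev (t # st) @ x # xs) b x" "prec (rev (t # st) @ x # xs) x a"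
          using 2 \<open>a \<in> set xs\<close> by (auto simp: prec_append)
        ultimately show ?thesis using tx 2 by blast
      next
        case F: False
        have "a \<notin> set st" using st 2 "4.prems"(3) by fastforce
        moreover have "a \<notin> set (x # xs)" using F by (auto simp: prec_append)
        moreover have "a \<noteq> t" using 2 "4.prems"(3) by simp
        ultimately show ?thesis by (auto simp: set_stack_run dest!: prec_in_set)
      qed
    next
      case 3
      have "prec (stack_run (t # st) (x # xs)) b a \<longleftrightarrow> prec (stack_run st (x # xs)) b a"
        using False 3 by simp
      also note IH
      also have "(\<exists>c>b. prec (rev st @ x # xs) b c \<and> prec (rev st @ x # xs) c a) \<longleftrightarrow>
        (\<exists>c>b. prec (rev (t # st) @ x # xs) b c \<and> prec (rev (t # st) @ x # xs) c a)"
      proof (intro ex_cong1 conj_cong refl)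
        fix c assume cb: "b < c"
        show "prec (rev st @ x # xs) b c = prec (rev (t # st) @ x # xs) b c"
        proof (cases "c = t")
          case True
          have "\<not> prec (rev (t # st) @ x # xs) b t"
            using True cb nt tx st[of b] 3 by (auto simp: prec_append prec_rev dest: prec_in_set)
          moreover have "\<not> prec (rev st @ x # xs) b t"
            using nt tx by (auto dest: prec_in_set)
          ultimately show ?thesis using True by simp
        next
          case False
          then show ?thesis using 3 prec_remove[of b t c "rev st" "x # xs"] by simp
        qed
        then show "prec (rev st @ x # xs) c a = prec (rev (t # st) @ x # xs) c a"
          if "prec (rev (t # st) @ x # xs) b c"
          using that nt tx 3 prec_remove[of c t a "rev st" "x # xs"]
          by (cases "c = t") (auto dest: prec_in_set)
      qed
      finally show ?thesis .
    qed
  qed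
qed auto

lemma prec_stack_sort:
  fixes a b :: "'a::linorder"
  assumes "distinct w" "a < b"
  shows "prec (stack_sort w) b a \<longleftrightarrow> (\<exists>c>b. prec w b c \<and> prec w c a)"
  using prec_stack_run[of "[]" w a b] assms by (simp add: stack_sort_def)

lemma set_stack_sort_pow: "set ((stack_sort ^^ i) w) = set w"
  by (induction i) (auto simp: stack_sort_def set_stack_run)

lemma distinct_stack_sort_pow: "distinct ((stack_sort ^^ i) w) \<longleftrightarrow> distinct w"
  by (induction i) (auto simp: stack_sort_def distinct_stack_run)

text \<open>Induction on the number of inversions. By the rule on pairs every inversion of
  \<open>stack_sort w\<close> is one of \<open>w\<close>; an inversion whose larger entry
  \<open>m\<close> is maximal disappears, since its witness would start an inversion with a still
  larger entry. Hence the \<open>LEAST\<close> in \<open>sc\<close> is attained.\<close>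

lemma stack_sort_eventually_sorted:
  fixes w :: "'a::linorder list"
  assumes "distinct w"
  shows "\<exists>k. sorted_wrt (<) ((stack_sort ^^ k) w)"
  using assms
proof (induction "card {(b, a). a < b \<and> prec w b a}" arbitrary: w rule: less_induct)
  case less
  define inv where "inv = (\<lambda>w::'a list. {(b, a). a < b \<and> prec w b a})"
  have fin: "finite (inv w)" for w
    by (rule finite_subset[of _ "set w \<times> set w"]) (auto simp: inv_def dest: prec_in_set)
  show ?case
  proof (cases "inv w = {}")
    case True
    then have "sorted_wrt (<) w"
      unfolding sorted_wrt_prec inv_def using less.prems prec_irrefl
      by (metis (mono_tags, lifting) Collect_empty_eq case_prodI linorder_neqE)
    then show ?thesis by (metis funpow_0)
  next
    case False
    define m where "m = Max (fst ` inv w)"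
    have "m \<in> fst ` inv w" unfolding m_def using False fin by (intro Max_in) auto
    then obtain a where a: "(m, a) \<in> inv w" by auto
    have mx: "c \<le> m" if "(c, d) \<in> inv w" for c d
      unfolding m_def using that fin by (intro Max_ge) force+
    have "inv (stack_sort w) \<subseteq> inv w"
      using less.prems prec_trans[OF less.prems] by (auto simp: inv_def prec_stack_sort)
    moreover have "(m, a) \<notin> inv (stack_sort w)"
    proof
      assume "(m, a) \<in> inv (stack_sort w)"
      then obtain c where "c > m" "prec w c a" "a < m"
        using less.prems by (auto simp: inv_def prec_stack_sort)
      then show False using mx[of c a] unfolding inv_def by fastforce
    qed
    ultimately have "card (inv (stack_sort w)) < card (inv w)"
      using a fin by (intro psubset_card_mono) auto
    then obtain k where "sorted_wrt (<) ((stack_sort ^^ k) (stack_sort w))"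
      using less.hyps[of "stack_sort w"] less.prems distinct_stack_sort_pow[of 1 w]
      unfolding inv_def by auto
    then have "sorted_wrt (<) ((stack_sort ^^ Suc k) w)"
      by (simp add: funpow_swap1)
    then show ?thesis by blast
  qed
qed

section \<open>Labels of the iterates\<close>

text \<open>
  Iterates are counted from 0 here, so \<open>champs \<pi> i\<close> is the set of entries of \<open>C_seq \<pi> (i + 1)\<close>.
  The champion \<open>keeper \<pi> i x\<close> is the one in whose block \<open>x\<close> lies (or \<open>x\<close> itself), and
  \<open>lab \<pi> i x\<close> is the row of that champion.
\<close>

definition ahead :: "nat list \<Rightarrow> nat \<Rightarrow> nat \<Rightarrow> nat \<Rightarrow> bool" where
  "ahead \<pi> i x y \<longleftrightarrow> prec ((stack_sort ^^ i) \<pi>) x y"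

definition active :: "nat list \<Rightarrow> nat \<Rightarrow> nat set" where
  "active \<pi> i = {x. ahead \<pi> i x 0}"

definition keeper :: "nat list \<Rightarrow> nat \<Rightarrow> nat \<Rightarrow> nat" where
  "keeper \<pi> i x = Max {y \<in> active \<pi> i. y = x \<or> ahead \<pi> i x y}"

definition champs :: "nat list \<Rightarrow> nat \<Rightarrow> nat set" where
  "champs \<pi> i = {x \<in> active \<pi> i. \<forall>y \<in> active \<pi> i. ahead \<pi> i x y \<longrightarrow> y < x}"

fun lab :: "nat list \<Rightarrow> nat \<Rightarrow> nat \<Rightarrow> nat" where
  "lab \<pi> 0 x = card {c \<in> champs \<pi> 0. keeper \<pi> 0 x \<le> c}"
| "lab \<pi> (Suc i) x = lab \<pi> i (keeper \<pi> (Suc i) x)"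

definition level :: "nat list \<Rightarrow> nat \<Rightarrow> nat" where
  "level \<pi> x = (THE i. x \<in> champs \<pi> i)"

text \<open>\<open>level\<close> counts from 0, hence the \<open>Suc\<close>; \<open>lab\<close>
  counts from 1 already, being a number of initial champions that includes the keeper
  itself.\<close>

definition tab :: "nat list \<Rightarrow> nat \<Rightarrow> nat \<times> nat" where
  "tab \<pi> x = (Suc (level \<pi> x), lab \<pi> (level \<pi> x) x)"

text \<open>The entries need not fill an interval, so that a word stays in the locale when its least
  positive entry is deleted.\<close>

locale zero_ended =
  fixes \<pi> :: "nat list"
  assumes distinct: "distinct \<pi>" and nonempty: "\<pi> \<noteq> []" and last_zero: "last \<pi> = 0"
begin

abbreviation "R \<equiv> ahead \<pi>"
abbreviation "act \<equiv> active \<pi>"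
abbreviation "K \<equiv> keeper \<pi>"
abbreviation "C \<equiv> champs \<pi>"
abbreviation "l \<equiv> lab \<pi>"

lemma distinct_pow: "distinct ((stack_sort ^^ i) \<pi>)"
  using distinct by (simp add: distinct_stack_sort_pow)

lemma zero_in: "0 \<in> set \<pi>"
  using nonempty last_zero last_in_set by metis

lemma R_trans: "R i x y \<Longrightarrow> R i y z \<Longrightarrow> R i x z"
  unfolding ahead_def using prec_trans distinct_pow by metis

lemma R_irrefl: "\<not> R i x x"
  unfolding ahead_def using prec_irrefl distinct_pow by metis

lemma R_asym: "R i x y \<Longrightarrow> \<not> R i y x"
  using R_trans R_irrefl by blast

lemma R_total: "x \<in> set \<pi> \<Longrightarrow> y \<in> set \<pi> \<Longrightarrow> x \<noteq> y \<Longrightarrow> R i x y \<or> R i y x"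
  unfolding ahead_def using prec_total set_stack_sort_pow by metis

lemma R_in_set: "R i x y \<Longrightarrow> x \<in> set \<pi> \<and> y \<in> set \<pi>"
  unfolding ahead_def using prec_in_set set_stack_sort_pow by metis

lemma R_Suc_desc: "a < b \<Longrightarrow> R (Suc i) b a \<longleftrightarrow> (\<exists>c>b. R i b c \<and> R i c a)"
  unfolding ahead_def using prec_stack_sort[OF distinct_pow] by simp

lemma R_Suc_asc:
  assumes "a < b" "R i a b"
  shows "R (Suc i) a b"
proof -
  have "\<not> R (Suc i) b a"
    using assms R_Suc_desc R_trans R_asym by blast
  then show ?thesis using assms R_total R_in_set by (metis less_not_refl)
qed

lemma active_sub: "x \<in> act i \<Longrightarrow> x \<in> set \<pi> - {0}"
  unfolding active_def using R_in_set R_irrefl by fastforce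

lemma finite_active: "finite (act i)"
  using active_sub by (metis finite_set finite_Diff finite_subset subsetI)

lemma active_0: "act 0 = set \<pi> - {0}"
proof (intro equalityI subsetI)
  fix x assume "x \<in> set \<pi> - {0}"
  then show "x \<in> act 0"
    using prec_last[OF distinct nonempty, of x] last_zero by (simp add: active_def ahead_def)
qed (rule active_sub)

lemma active_total: "x \<in> act i \<Longrightarrow> y \<in> act j \<Longrightarrow> x \<noteq> y \<Longrightarrow> R k x y \<or> R k y x"
  using active_sub R_total by blast

lemma R_active: "R i x y \<Longrightarrow> y \<in> act i \<Longrightarrow> x \<in> act i"
  unfolding active_def using R_trans by blast

text \<open>By the rule on pairs with 0 as the smaller entry, a positive entry stays in front of 0
  iff a larger one lies between them. So each pass moves exactly the champions behind 0.\<close>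

lemma active_Suc: "act (Suc i) = act i - C i"
proof (intro set_eqI)
  fix x
  show "x \<in> act (Suc i) \<longleftrightarrow> x \<in> act i - C i"
  proof (cases "x \<in> set \<pi> - {0}")
    case True
    then have "x \<in> act (Suc i) \<longleftrightarrow> (\<exists>c>x. R i x c \<and> R i c 0)"
      unfolding active_def using R_Suc_desc by simp
    also have "\<dots> \<longleftrightarrow> x \<in> act i - C i"
    proof
      assume "\<exists>c>x. R i x c \<and> R i c 0"
      then obtain c where c: "c > x" "R i x c" "c \<in> act i" by (auto simp: active_def)
      then show "x \<in> act i - C i" using R_active[OF c(2,3)] by (force simp: champs_def)
    next
      assume "x \<in> act i - C i"
      then obtain y where y: "y \<in> act i" "R i x y" "\<not> y < x" by (auto simp: champs_def)
      then have "y \<noteq> x" using R_irrefl by metis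
      then have "y > x" using y(3) by simp
      then show "\<exists>c>x. R i x c \<and> R i c 0" using y by (auto simp: active_def)
    qed
    finally show ?thesis .
  next
    case False
    then show ?thesis using active_sub by blast
  qed
qed

lemma active_Suc_sub: "x \<in> act (Suc i) \<Longrightarrow> x \<in> act i"
  using active_Suc by blast

lemma champs_active: "x \<in> C i \<Longrightarrow> x \<in> act i"
  unfolding champs_def by blast

lemma keeper_props:
  assumes "x \<in> act i"
  shows "K i x \<in> act i" "K i x = x \<or> R i x (K i x)" "\<And>y. y \<in> act i \<Longrightarrow> R i x y \<Longrightarrow> y \<le> K i x" "x \<le> K i x"
proof -
  let ?S = "{y \<in> act i. y = x \<or> R i x y}"
  have fin: "finite ?S" using finite_active by simp
  then have "K i x \<in> ?S" unfolding keeper_def using assms by (intro Max_in) auto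
  then show "K i x \<in> act i" "K i x = x \<or> R i x (K i x)" by auto
  show "\<And>y. y \<in> act i \<Longrightarrow> R i x y \<Longrightarrow> y \<le> K i x" "x \<le> K i x"
    unfolding keeper_def using fin assms by (auto intro: Max_ge)
qed

lemma keeper_champ: "x \<in> act i \<Longrightarrow> K i x \<in> C i"
proof -
  assume x: "x \<in> act i"
  have "y < K i x" if y: "y \<in> act i" "R i (K i x) y" for y
  proof -
    have "R i x y" using keeper_props(2)[OF x] y(2) R_trans by metis
    then have "y \<le> K i x" using keeper_props(3)[OF x] y(1) by blast
    moreover have "y \<noteq> K i x" using y(2) R_irrefl by metis
    ultimately show ?thesis by simp
  qed
  then show ?thesis using keeper_props(1)[OF x] by (simp add: champs_def)
qed

lemma champ_keeper_eq: "x \<in> C i \<Longrightarrow> K i x = x"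
  using keeper_props[of x i] unfolding champs_def by fastforce

lemma champ_iff: "x \<in> act i \<Longrightarrow> x \<in> C i \<longleftrightarrow> K i x = x"
  using champ_keeper_eq keeper_champ by metis

lemma champs_desc: "c \<in> C i \<Longrightarrow> d \<in> C i \<Longrightarrow> d < c \<Longrightarrow> R i c d"
  unfolding champs_def using active_total[of c i d i i] by fastforce

text \<open>Here \<open>x\<close> lies in an earlier block than \<open>y\<close>, and the champion
  \<open>K i x\<close> stands between them. If \<open>x < y\<close>, the ascending pair keeps its
  order; if \<open>y < x\<close>, that champion is the witness that keeps \<open>x\<close> in
  front.\<close>

lemma keeper_less_R:
  assumes "x \<in> act (Suc i)" "y \<in> act (Suc i)" "K i y < K i x"
  shows "R (Suc i) x y"
proof -
  have x: "x \<in> act i" "x \<notin> C i" and y: "y \<in> act i" using assms active_Suc by auto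
  then have kx: "K i x \<noteq> x" using champ_iff by blast
  then have xk: "R i x (K i x)" "x < K i x" using keeper_props[of x i] x by auto
  have "\<not> R i y (K i x)" "K i x \<noteq> y"
    using keeper_props[of y i] keeper_props(1)[of x i] x y assms(3) by fastforce+
  then have ky: "R i (K i x) y" using active_total keeper_props(1) x y by metis
  show ?thesis
  proof (cases "x < y")
    case True
    then show ?thesis using R_Suc_asc R_trans xk ky by blast
  next
    case False
    moreover have "x \<noteq> y" using assms(3) by auto
    ultimately show ?thesis using R_Suc_desc xk ky by (metis linorder_neqE_nat)
  qed
qed

text \<open>If \<open>c\<close> came first, it would exceed \<open>x\<close>, and the pair would
  need a witness \<open>d > c\<close> between them. This \<open>d\<close> precedes the champion of
  the block, so it is no champion itself; it survives the pass behind \<open>c\<close>, and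
  \<open>c\<close> would be no champion. In particular a block yields at most one new
  champion.\<close>

lemma keeper_eq_R:
  assumes "x \<in> act (Suc i)" "c \<in> C (Suc i)" "K i x = K i c" "x \<noteq> c"
  shows "R (Suc i) x c"
proof (rule ccontr)
  assume "\<not> R (Suc i) x c"
  have c: "c \<in> act (Suc i)" using assms champs_active by blast
  then have cx: "R (Suc i) c x" using \<open>\<not> R (Suc i) x c\<close> assms active_total by blast
  then have "x < c" using assms unfolding champs_def by blast
  then obtain d where d: "d > c" "R i c d" "R i d x" using cx R_Suc_desc by blast
  have x: "x \<in> act i" "x \<notin> C i" using assms active_Suc by auto
  have di: "d \<in> act i" using d(3) x R_active by blast
  have "R i x (K i x)" using x champ_iff keeper_props by blast
  then have "R i d (K i x)" using d R_trans by blast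
  moreover have "d \<le> K i x" using d(2) di assms(3) keeper_props(3) c active_Suc_sub by metis
  ultimately have "d \<notin> C i" using keeper_props(1) x unfolding champs_def by fastforce
  then have "d \<in> act (Suc i)" using di active_Suc by blast
  moreover have "R (Suc i) c d" using d R_Suc_asc by blast
  ultimately show False using assms(2) d(1) unfolding champs_def by fastforce
qed

section \<open>Order and monotonicity of the labels\<close>

lemma finite_champs: "finite (C i)"
  using finite_active unfolding champs_def by simp

lemma lab_keeper: "x \<in> act i \<Longrightarrow> l i (K i x) = l i x"
  using champ_keeper_eq keeper_champ by (cases i) auto

lemma lab_Suc_champ: "c \<in> C (Suc i) \<Longrightarrow> l (Suc i) c = l i c"
  using champ_keeper_eq by simp

text \<open>Larger keepers stand further left, so this says that labels increase from block to
  block. Initially labels are ranks; later, two champions come from different blocks of the pass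
  before, in the same order, by \<open>keeper_less_R\<close> and \<open>keeper_eq_R\<close>.\<close>

lemma keeper_less_lab: "x \<in> act i \<Longrightarrow> y \<in> act i \<Longrightarrow> K i y < K i x \<Longrightarrow> l i x < l i y"
proof (induction i arbitrary: x y)
  case 0
  have "{c \<in> C 0. K 0 x \<le> c} \<subset> {c \<in> C 0. K 0 y \<le> c}"
  proof
    show "{c \<in> C 0. K 0 x \<le> c} \<subseteq> {c \<in> C 0. K 0 y \<le> c}" using 0 by auto
    have "K 0 y \<in> {c \<in> C 0. K 0 y \<le> c} - {c \<in> C 0. K 0 x \<le> c}"
      using 0 keeper_champ[of y 0] by auto
    then show "{c \<in> C 0. K 0 x \<le> c} \<noteq> {c \<in> C 0. K 0 y \<le> c}" by blast
  qed
  then show ?case using finite_champs by (simp add: psubset_card_mono)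
next
  case (Suc i)
  define c d where "c = K (Suc i) x" and "d = K (Suc i) y"
  have cd: "c \<in> C (Suc i)" "d \<in> C (Suc i)" "d < c"
    using Suc keeper_champ unfolding c_def d_def by auto
  then have R: "R (Suc i) c d" using champs_desc by blast
  have act: "c \<in> act (Suc i)" "d \<in> act (Suc i)" using cd champs_active by auto
  have "K i d < K i c"
  proof (rule ccontr)
    assume "\<not> K i d < K i c"
    then consider "K i c < K i d" | "K i d = K i c" by linarith
    then have "R (Suc i) d c"
      using keeper_less_R keeper_eq_R act cd by cases auto
    then show False using R R_asym by blast
  qed
  then have "l i c < l i d" using Suc.IH act active_Suc_sub by blast
  then show ?case unfolding c_def d_def by simp
qed

lemma lab_less_iff: "x \<in> act i \<Longrightarrow> y \<in> act i \<Longrightarrow> l i x < l i y \<longleftrightarrow> K i y < K i x"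
  using keeper_less_lab lab_keeper by (metis linorder_less_linear order.asym)

lemma lab_inj: "c \<in> C i \<Longrightarrow> d \<in> C i \<Longrightarrow> l i c = l i d \<Longrightarrow> c = d"
  using keeper_less_lab champs_active champ_keeper_eq by (metis linorder_neqE_nat less_irrefl)

text \<open>A drop of the label would put the new keeper in an earlier old block, hence in front of
  \<open>x\<close>, whereas a keeper is \<open>x\<close> itself or lies behind it.\<close>

lemma lab_Suc_ge:
  assumes "x \<in> act (Suc i)" shows "l i x \<le> l (Suc i) x"
proof (rule ccontr)
  let ?d = "K (Suc i) x"
  assume "\<not> ?thesis"
  then have "l i ?d < l i x" by simp
  moreover have d: "?d \<in> act (Suc i)" using assms keeper_props by blast
  ultimately have "K i x < K i ?d" using lab_less_iff assms active_Suc_sub by blast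
  then have "R (Suc i) ?d x" using keeper_less_R assms d by blast
  then show False using keeper_props(2)[OF assms] R_asym R_irrefl by metis
qed

text \<open>When an entry moves on to a later row, all rows passed over have just ended.\<close>

lemma no_champ_between:
  assumes "x \<in> act (Suc i)" "c \<in> C (Suc i)" "l i x \<le> l (Suc i) c"
  shows "l (Suc i) x \<le> l (Suc i) c"
proof (rule ccontr)
  let ?d = "K (Suc i) x"
  assume "\<not> ?thesis"
  then have cd: "l i c < l i ?d" and xc: "l i x \<le> l i c"
    using assms lab_Suc_champ by auto
  have act: "?d \<in> act (Suc i)" "c \<in> act (Suc i)" "x \<in> act i" "?d \<in> act i" "c \<in> act i"
    using assms keeper_props champs_active active_Suc_sub by auto
  then have "K i ?d < K i c" using cd lab_less_iff by blast
  then have Rcd: "R (Suc i) c ?d" using keeper_less_R act by blast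
  then have "?d < c" using assms(2) act unfolding champs_def by blast
  have "K i c \<le> K i x" using xc lab_less_iff act by (metis not_le)
  then have "x = c \<or> R (Suc i) x c"
    using keeper_less_R keeper_eq_R assms act by (metis order_le_less)
  then have "c \<le> ?d" using keeper_props assms act by metis
  then show False using \<open>?d < c\<close> by simp
qed

text \<open>A row with a champion at one level had one at the level before, so rows fill without
  gaps.\<close>

lemma champ_pred: "c \<in> C (Suc i) \<Longrightarrow> K i c \<in> C i \<and> l i (K i c) = l (Suc i) c"
  using champs_active active_Suc_sub keeper_champ lab_keeper lab_Suc_champ by metis

text \<open>Iterates \<open>no_champ_between\<close>. A champion of a passed row at the current
  level would have a predecessor in the same row one level earlier, which allows the induction to
  compare with \<open>l 0 x\<close>.\<close>

lemma no_champ_passed: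
  "x \<in> act i \<Longrightarrow> c \<in> C i \<Longrightarrow> l 0 x \<le> l i c \<Longrightarrow> l i x \<le> l i c"
proof (induction i arbitrary: c)
  case (Suc i)
  have "l i x \<le> l i (K i c)"
    using Suc.IH[of "K i c"] Suc.prems champ_pred active_Suc_sub by simp
  then show ?case using no_champ_between Suc.prems champ_pred by metis
qed simp

lemma lab_0_le: "x \<in> act i \<Longrightarrow> l 0 x \<le> l i x"
proof (induction i)
  case (Suc i)
  then show ?case using lab_Suc_ge active_Suc_sub order_trans by blast
qed simp

section \<open>Every positive entry is a champion at exactly one level\<close>

lemma active_mono: "i \<le> j \<Longrightarrow> act j \<subseteq> act i"
  by (induction j rule: dec_induct) (use active_Suc in auto)

lemma champs_level_unique:
  assumes "x \<in> C i" "x \<in> C j" shows "i = j"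
proof -
  have "False" if "x \<in> C i" "x \<in> C j" "i < j" for i j
    using that active_Suc active_mono[of "Suc i" j] champs_active by fastforce
  then show ?thesis using assms by (metis linorder_neqE_nat)
qed

lemma active_sc: "act (sc \<pi>) = {}"
proof -
  have "sorted_wrt (<) ((stack_sort ^^ sc \<pi>) \<pi>)"
    unfolding sc_def using stack_sort_eventually_sorted[OF distinct] by (rule LeastI_ex)
  then show ?thesis
    unfolding active_def ahead_def sorted_wrt_prec by fastforce
qed

text \<open>Otherwise \<open>x\<close> would stay in front of 0 up to the sorted iterate, in which
  nothing precedes 0.\<close>

lemma champ_ex:
  assumes "x \<in> set \<pi> - {0}" shows "\<exists>i < sc \<pi>. x \<in> C i"
proof (rule ccontr)
  assume *: "\<not> ?thesis"
  have "i \<le> sc \<pi> \<Longrightarrow> x \<in> act i" for i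
    by (induction i) (use * assms active_0 active_Suc in auto)
  then show False using active_sc by auto
qed

lemma level_eq: "x \<in> C i \<Longrightarrow> level \<pi> x = i"
  unfolding level_def using champs_level_unique by blast

lemma level_champ: "x \<in> set \<pi> - {0} \<Longrightarrow> x \<in> C (level \<pi> x)"
  using champ_ex level_eq by metis

lemma tab_eq: "x \<in> C i \<Longrightarrow> tab \<pi> x = (Suc i, l i x)"
  by (simp add: tab_def level_eq)

lemma champs_0_eq: "C 0 = {x \<in> set \<pi> - {0}. fst (tab \<pi> x) = 1}"
proof (intro equalityI subsetI)
  fix x assume x: "x \<in> C 0"
  then show "x \<in> {x \<in> set \<pi> - {0}. fst (tab \<pi> x) = 1}"
    using active_sub[OF champs_active[OF x]] tab_eq[OF x] by simp
next
  fix x assume x: "x \<in> {x \<in> set \<pi> - {0}. fst (tab \<pi> x) = 1}"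
  then show "x \<in> C 0" using level_champ[of x] by (simp add: tab_def)
qed

lemma tab_image: "(Suc i, k) \<in> tab \<pi> ` (set \<pi> - {0}) \<longleftrightarrow> (\<exists>c \<in> C i. l i c = k)"
proof
  assume "(Suc i, k) \<in> tab \<pi> ` (set \<pi> - {0})"
  then show "\<exists>c \<in> C i. l i c = k"
    using level_champ by (auto simp: tab_def)
next
  assume "\<exists>c \<in> C i. l i c = k"
  then obtain c where "c \<in> C i" "l i c = k" by blast
  then show "(Suc i, k) \<in> tab \<pi> ` (set \<pi> - {0})"
    using tab_eq active_sub champs_active by (metis imageI)
qed

end

section \<open>Agreement with the tableau of a permutation\<close>

text \<open>These are the right-to-left maxima: the overall maximum is the leftmost of them, it
  rules out everything before it, and the others are the right-to-left maxima of the part behind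
  it.\<close>

lemma champions_props:
  assumes "distinct xs"
  shows "set (champions xs) = {x \<in> set xs. \<forall>y. prec xs x y \<longrightarrow> y < x} \<and>
    sorted_wrt (>) (champions xs)"
  using assms
proof (induction xs rule: champions.induct)
  case (1 xs)
  show ?case
  proof (cases "xs = []")
    case True
    then show ?thesis by (simp add: champions.simps)
  next
    case False
    define m where "m = Max (set xs)"
    have m: "m \<in> set xs" "\<And>y. y \<in> set xs \<Longrightarrow> y \<le> m"
      unfolding m_def using False by auto
    have champ: "champions xs = m # champions (after m xs)"
      using False by (subst champions.simps) (simp add: m_def)
    have IH: "set (champions (after m xs)) =
        {x. prec xs m x \<and> (\<forall>y. prec xs x y \<and> prec xs m x \<longrightarrow> y < x)}"
      "sorted_wrt (>) (champions (after m xs))"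
      using 1(1)[OF False] distinct_after[OF 1(2), of m]
      unfolding m_def[symmetric] by (simp_all add: set_after prec_after 1(2))
    have mx: "y < m" if "prec xs m y" for y
      using that m prec_in_set[OF that] prec_irrefl[OF 1(2)] by (metis order_le_less)
    have "x = m \<or> prec xs m x" if "x \<in> set xs" "\<forall>y. prec xs x y \<longrightarrow> y < x" for x
      using that m prec_total by (metis not_le)
    then have "set (champions xs) = {x \<in> set xs. \<forall>y. prec xs x y \<longrightarrow> y < x}"
      unfolding champ using IH(1) mx m(1) by (auto dest: prec_in_set)
    then show ?thesis using IH mx unfolding champ by auto
  qed
qed

lemma distinct_if_descending: "sorted_wrt (>) (xs :: 'a::linorder list) \<Longrightarrow> distinct xs"
  by (induction xs) auto

lemma rank_nth:
  fixes xs :: "'a::linorder list"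
  assumes "sorted_wrt (>) xs" "j < length xs"
  shows "card {c \<in> set xs. xs ! j \<le> c} = Suc j"
proof -
  have less: "xs ! b < xs ! a" if "a < b" "b < length xs" for a b
    using sorted_wrt_nth_less[OF assms(1) that] by simp
  have "{c \<in> set xs. xs ! j \<le> c} = (!) xs ` {..j}"
  proof (intro equalityI subsetI)
    fix c assume "c \<in> {c \<in> set xs. xs ! j \<le> c}"
    then obtain a where a: "c = xs ! a" "a < length xs" "xs ! j \<le> xs ! a"
      by (auto simp: in_set_conv_nth)
    then have "a \<le> j" using less by (metis not_le)
    then show "c \<in> (!) xs ` {..j}" using a by auto
  next
    fix c assume "c \<in> (!) xs ` {..j}"
    then obtain a where a: "c = xs ! a" "a \<le> j" by auto
    then have "xs ! j \<le> c" using less[of a j] assms(2) by (cases "a = j") auto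
    then show "c \<in> {c \<in> set xs. xs ! j \<le> c}" using a assms(2) by auto
  qed
  moreover have "inj_on ((!) xs) {..j}"
  proof (rule inj_onI)
    fix a b assume "a \<in> {..j}" "b \<in> {..j}" "xs ! a = xs ! b"
    then show "a = b" using less[of a b] less[of b a] assms(2)
      by (cases a b rule: linorder_cases) auto
  qed
  ultimately show ?thesis by (simp add: card_image)
qed

context zero_ended
begin

lemma C_seq_props:
  "set (C_seq \<pi> (Suc i)) = C i" "sorted_wrt (>) (C_seq \<pi> (Suc i))"
proof -
  let ?w = "(stack_sort ^^ i) \<pi>"
  have z: "0 \<in> set ?w" using zero_in by (simp add: set_stack_sort_pow)
  have act: "set (before 0 ?w) = act i"
    unfolding set_before[OF distinct_pow z] active_def ahead_def ..
  have pr: "prec (before 0 ?w) x y \<longleftrightarrow> R i x y \<and> y \<in> act i" for x y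
    unfolding prec_before[OF distinct_pow z] active_def ahead_def by simp
  show "set (C_seq \<pi> (Suc i)) = C i" "sorted_wrt (>) (C_seq \<pi> (Suc i))"
    using champions_props[OF distinct_before[OF distinct_pow, of 0 i]]
    unfolding C_seq_def sigma_def diff_Suc_1 act pr champs_def by auto
qed

text \<open>The 1-based position in \<open>C_seq\<close>, written as a cardinality to match the
  initial value of \<open>lab\<close>.\<close>

definition rank :: "nat \<Rightarrow> nat \<Rightarrow> nat" where
  "rank i c = card {d \<in> C i. c \<le> d}"

lemma rank_c_entry:
  assumes "j \<in> {1..length (C_seq \<pi> (Suc i))}"
  shows "c_entry \<pi> (Suc i) j \<in> C i" "rank i (c_entry \<pi> (Suc i) j) = j"
proof -
  have j: "j - 1 < length (C_seq \<pi> (Suc i))" using assms by auto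
  then show "c_entry \<pi> (Suc i) j \<in> C i"
    unfolding c_entry_def using C_seq_props(1) nth_mem by blast
  show "rank i (c_entry \<pi> (Suc i) j) = j"
    using rank_nth[OF C_seq_props(2) j] assms unfolding rank_def c_entry_def C_seq_props(1) by auto
qed

lemma c_entry_rank:
  assumes "c \<in> C i"
  shows "rank i c \<in> {1..length (C_seq \<pi> (Suc i))}" "c_entry \<pi> (Suc i) (rank i c) = c"
proof -
  obtain a where a: "a < length (C_seq \<pi> (Suc i))" "C_seq \<pi> (Suc i) ! a = c"
    using assms C_seq_props(1) by (metis in_set_conv_nth)
  then have c: "c = c_entry \<pi> (Suc i) (Suc a)" by (simp add: c_entry_def)
  then have "rank i c = Suc a" using rank_c_entry(2)[of "Suc a" i] a by auto
  then show "rank i c \<in> {1..length (C_seq \<pi> (Suc i))}" "c_entry \<pi> (Suc i) (rank i c) = c"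
    using a c by auto
qed

lemma rank_less: "c \<in> C i \<Longrightarrow> d < c \<Longrightarrow> d \<in> C i \<Longrightarrow> rank i c < rank i d"
  unfolding rank_def
proof (rule psubset_card_mono)
  assume "c \<in> C i" "d < c" "d \<in> C i"
  then have "d \<in> {e \<in> C i. d \<le> e} - {e \<in> C i. c \<le> e}" "{e \<in> C i. c \<le> e} \<subseteq> {e \<in> C i. d \<le> e}" by auto
  then show "{e \<in> C i. c \<le> e} \<subset> {e \<in> C i. d \<le> e}" by blast
qed (use finite_champs in simp)

lemma coords_eq:
  assumes "x \<in> C i" shows "coords \<pi> x = (Suc i, rank i x)"
  unfolding coords_def
proof (rule the_equality)
  have "i < sc \<pi>"
    using champ_ex[of x] champs_level_unique assms champs_active active_sub by metis
  then show "case (Suc i, rank i x) of (i, j) \<Rightarrow>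
      i \<in> {1..sc \<pi>} \<and> j \<in> {1..length (C_seq \<pi> i)} \<and> x = c_entry \<pi> i j"
    using c_entry_rank[OF assms] by auto
next
  fix p
  assume p: "case p of (i, j) \<Rightarrow>
      i \<in> {1..sc \<pi>} \<and> j \<in> {1..length (C_seq \<pi> i)} \<and> x = c_entry \<pi> i j"
  obtain a b where ab: "p = (a, b)" by (cases p)
  then obtain a' where a': "a = Suc a'" using p by (cases a) auto
  have b: "b \<in> {1..length (C_seq \<pi> (Suc a'))}" "x = c_entry \<pi> (Suc a') b" using p ab a' by auto
  then have "x \<in> C a'" "rank a' x = b" using rank_c_entry by auto
  then show "p = (Suc i, rank i x)" using ab a' champs_level_unique assms by auto
qed

lemma col_eq: "x \<in> C i \<Longrightarrow> col \<pi> x = Suc i"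
  by (simp add: col_def coords_eq)

text \<open>A block collects the entries with a common keeper. For an entry between two consecutive
  champions, any other keeper would have a rank strictly between \<open>j - 1\<close> and
  \<open>j\<close>; for \<open>j = 1\<close> it would have rank 0.\<close>

lemma set_block:
  assumes j: "j \<in> {1..length (C_seq \<pi> (Suc i))}"
  shows "set (block \<pi> (Suc i) j) = {y \<in> act i. K i y = c_entry \<pi> (Suc i) j \<and> y \<noteq> c_entry \<pi> (Suc i) j}"
proof -
  let ?w = "(stack_sort ^^ i) \<pi>"
  define c where "c = c_entry \<pi> (Suc i) j"
  have c: "c \<in> C i" "rank i c = j" using rank_c_entry[OF j] by (auto simp: c_def)
  have cw: "c \<in> set ?w" using c champs_active active_sub set_stack_sort_pow by fastforce
  have Rc: "R i y c" if "y \<in> act i" "K i y = c" "y \<noteq> c" for y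
    using keeper_props(2) that by metis
  have up: "c \<le> K i y \<and> y \<in> act i \<and> y \<noteq> c \<and> K i y \<in> C i" if "R i y c" for y
    using that keeper_props(3) c champs_active R_active R_irrefl keeper_champ by metis
  show ?thesis
  proof (cases "j = 1")
    case True
    have "K i y = c" if "R i y c" for y
    proof (rule ccontr)
      assume "K i y \<noteq> c"
      then have "rank i (K i y) < 1" using rank_less[of "K i y" i c] up[OF that] c True by auto
      then show False using c_entry_rank(1)[of "K i y" i] up[OF that] by auto
    qed
    then have "{y. R i y c} = {y \<in> act i. K i y = c \<and> y \<noteq> c}" using Rc up by blast
    moreover have "set (block \<pi> (Suc i) j) = {y. R i y c}"
      using True c_def set_before[OF distinct_pow cw]
      unfolding block_def sigma_def ahead_def by simp
    ultimately show ?thesis unfolding c_def by simp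
  next
    case False
    define d where "d = c_entry \<pi> (Suc i) (j - 1)"
    have "j - 1 \<in> {1..length (C_seq \<pi> (Suc i))}" using j False by auto
    then have d: "d \<in> C i" "rank i d = j - 1" unfolding d_def by (rule rank_c_entry)+
    have "c < d"
      using rank_less[of c i d] c d j False by (cases c d rule: linorder_cases) auto
    then have Rdc: "R i d c" using champs_desc c d by blast
    have "K i y = c" if y: "R i y c" "R i d y" for y
    proof (rule ccontr)
      assume "K i y \<noteq> c"
      then have "rank i (K i y) < j" using rank_less[of "K i y" i c] up[OF y(1)] c by auto
      have "R i d (K i y)" using keeper_props(2) y(2) up[OF y(1)] R_trans by metis
      then have "K i y < d" using d(1) up[OF y(1)] champs_active unfolding champs_def by blast
      then have "j - 1 < rank i (K i y)" using rank_less[of d i "K i y"] d up[OF y(1)] by auto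
      then show False using \<open>rank i (K i y) < j\<close> by linarith
    qed
    moreover have "R i d y" if y: "y \<in> act i" "K i y = c" for y
    proof -
      have "y \<noteq> d" using y \<open>c < d\<close> champ_keeper_eq d by auto
      moreover have "\<not> R i y d" using y \<open>c < d\<close> keeper_props(3) d champs_active by fastforce
      ultimately show ?thesis using active_total y d champs_active by blast
    qed
    ultimately have "{y. R i y c \<and> R i d y} = {y \<in> act i. K i y = c \<and> y \<noteq> c}"
      using Rc up by blast
    moreover have "set (block \<pi> (Suc i) j) = {y. R i y c \<and> R i d y}"
    proof -
      have "c \<in> set (after d ?w)" using Rdc set_after[OF distinct_pow] by (simp add: ahead_def)
      then have "set (before c (after d ?w)) = {y. R i y c \<and> R i d y}"
        using set_before[OF distinct_after[OF distinct_pow]] prec_after[OF distinct_pow]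
        by (simp add: ahead_def)
      then show ?thesis using False unfolding block_def sigma_def c_def d_def by simp
    qed
    ultimately show ?thesis unfolding c_def by simp
  qed
qed

text \<open>If the maximum \<open>m\<close> of the block exceeded the new champion \<open>x\<close>,
  it would have to precede \<open>x\<close> after the pass. The witness \<open>d > m\<close> for
  this pair would lie in the same block, against the choice of \<open>m\<close>.\<close>

lemma champ_Suc_block_max:
  assumes x: "x \<in> C (Suc i)" and y: "y \<in> act i" "K i y = K i x" "y \<noteq> K i x"
  shows "y \<le> x"
proof (rule ccontr)
  define S where "S = {y \<in> act i. K i y = K i x \<and> y \<noteq> K i x}"
  define m where "m = Max S"
  assume "\<not> y \<le> x"
  have fin: "finite S" unfolding S_def using finite_active by simp
  have yS: "y \<in> S" using y by (simp add: S_def)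
  have m: "m \<in> S" "\<And>u. u \<in> S \<Longrightarrow> u \<le> m"
    unfolding m_def using fin yS by (blast intro: Max_in Max_ge)+
  then have xm: "x < m" using \<open>\<not> y \<le> x\<close> m(2)[OF yS] by simp
  have xi: "x \<in> act i" "x \<in> act (Suc i)" using x champs_active active_Suc_sub by auto
  have mi: "m \<in> act i" "K i m = K i x" "m \<noteq> K i x" using m(1) by (auto simp: S_def)
  then have ms: "m \<in> act (Suc i)" using active_Suc champ_iff by auto
  have "\<not> R (Suc i) x m" using x xm ms unfolding champs_def by fastforce
  then have "R (Suc i) m x" using active_total ms xi xm by (metis less_irrefl)
  then obtain d where d: "d > m" "R i m d" "R i d x" using R_Suc_desc xm by blast
  have di: "d \<in> act i" using d xi R_active by blast
  have "K i x \<noteq> x" using xi active_Suc champ_iff by auto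
  then have Kx: "R i x (K i x)" using keeper_props(2)[OF xi(1)] by simp
  then have Rd: "R i d (K i x)" using d R_trans by blast
  have "K i d \<le> K i m"
  proof -
    have "R i m (K i d)" using keeper_props(2)[OF di] d R_trans by metis
    then show ?thesis using keeper_props(3)[OF mi(1)] keeper_props(1)[OF di] by blast
  qed
  moreover have "K i x \<le> K i d" using Rd keeper_props(1)[OF xi(1)] keeper_props(3)[OF di] by blast
  moreover have "d \<noteq> K i x" using Rd R_irrefl by metis
  ultimately have "d \<in> S" using di mi by (simp add: S_def)
  then show False using m(2) d(1) by fastforce
qed

text \<open>By \<open>champ_Suc_block_max\<close>, \<open>x\<close> is the maximum of the block in
  front of its keeper one pass earlier. Any other index satisfying the description would give
  \<open>x\<close> a second keeper.\<close>

lemma leftof_eq: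
  assumes x: "x \<in> C (Suc i)"
  shows "leftof \<pi> x = K i x"
proof -
  let ?P = "\<lambda>j. j \<in> {1..length (C_seq \<pi> (Suc i))} \<and>
    block \<pi> (Suc i) j \<noteq> [] \<and> x = Max (set (block \<pi> (Suc i) j))"
  have xi: "x \<in> act i" "x \<noteq> K i x"
    using x champs_active active_Suc champ_iff by fastforce+
  have k: "K i x \<in> C i" using keeper_champ xi by blast
  have "(THE j. ?P j) = rank i (K i x)"
  proof (rule the_equality)
    have r: "rank i (K i x) \<in> {1..length (C_seq \<pi> (Suc i))}" using c_entry_rank k by blast
    have b: "set (block \<pi> (Suc i) (rank i (K i x))) = {y \<in> act i. K i y = K i x \<and> y \<noteq> K i x}"
      using set_block[OF r] c_entry_rank(2)[OF k] by simp
    have mx: "Max {y \<in> act i. K i y = K i x \<and> y \<noteq> K i x} = x"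
      using xi champ_Suc_block_max[OF x] finite_active by (intro Max_eqI) auto
    have "x \<in> set (block \<pi> (Suc i) (rank i (K i x)))" using b xi by blast
    then have ne: "block \<pi> (Suc i) (rank i (K i x)) \<noteq> []" by force
    show "?P (rank i (K i x))" by (intro conjI r ne) (simp only: b mx)
  next
    fix j assume j: "?P j"
    then have "x \<in> set (block \<pi> (Suc i) j)"
      using Max_in[of "set (block \<pi> (Suc i) j)"] by simp
    then have "K i x = c_entry \<pi> (Suc i) j" using set_block j by blast
    then show "j = rank i (K i x)" using rank_c_entry(2) j by simp
  qed
  then show ?thesis
    unfolding leftof_def using col_eq[OF x] c_entry_rank(2)[OF k] by simp
qed

text \<open>With \<open>leftof\<close> identified as the keeper, the recursion of \<open>row\<close>
  follows the same champions as that of \<open>lab\<close>.\<close>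

lemma row_eq: "x \<in> C i \<Longrightarrow> row \<pi> x = l i x"
proof (induction i arbitrary: x)
  case 0
  then have "row \<pi> x = rank 0 x"
    by (subst row.simps) (simp add: col_eq colpos_def coords_eq)
  then show ?case using champ_keeper_eq[OF 0] by (simp add: rank_def)
next
  case (Suc i)
  then have "row \<pi> x = row \<pi> (K i x)"
    by (subst row.simps) (simp add: col_eq leftof_eq)
  then show ?case using Suc.IH champ_pred[OF Suc.prems] by metis
qed

lemma T_of_eq_tab: "x \<in> set \<pi> - {0} \<Longrightarrow> T_of \<pi> x = tab \<pi> x"
  using level_champ row_eq col_eq by (simp add: T_of_def tab_def)

lemma length_C_seq_1: "length (C_seq \<pi> 1) = card {x \<in> set \<pi> - {0}. fst (tab \<pi> x) = 1}"
proof -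
  have "distinct (C_seq \<pi> 1)"
    using distinct_if_descending C_seq_props(2)[of 0] by simp
  then have "length (C_seq \<pi> 1) = card (C 0)"
    using C_seq_props(1)[of 0] distinct_card by fastforce
  then show ?thesis by (simp add: champs_0_eq)
qed

end

section \<open>Inserting a new least entry\<close>

text \<open>The right neighbour \<open>y\<close> may be 0; this is the case in which
  \<open>z\<close> opens a new row.\<close>

locale min_inserted =
  fixes us vs :: "nat list" and z y :: nat
  assumes ze: "zero_ended (us @ z # y # vs)"
    and z_pos: "z \<noteq> 0"
    and z_min: "\<And>x. x \<in> set (us @ y # vs) \<Longrightarrow> x \<noteq> 0 \<Longrightarrow> z < x"
begin

abbreviation "\<pi> \<equiv> us @ z # y # vs"
abbreviation "\<pi>' \<equiv> us @ y # vs"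

sublocale big: zero_ended \<pi> by (rule ze)

sublocale small: zero_ended \<pi>'
  using ze unfolding zero_ended_def by auto

text \<open>In a descending pair the larger entry is positive, hence greater than \<open>z\<close>,
  and the witness is greater still. So \<open>z\<close> never serves as a witness for other
  entries.\<close>

lemma ahead_remove: "x \<noteq> z \<Longrightarrow> w \<noteq> z \<Longrightarrow> ahead \<pi> i x w \<longleftrightarrow> ahead \<pi>' i x w"
proof (induction i arbitrary: x w)
  case 0
  then show ?case using prec_remove[of x z w us "y # vs"] by (simp add: ahead_def)
next
  case (Suc i)
  have desc: "ahead \<pi> (Suc i) b a \<longleftrightarrow> ahead \<pi>' (Suc i) b a"
    if ab: "a < b" "a \<noteq> z" "b \<noteq> z" "b \<in> set \<pi>'" for a b
  proof -
    have "z < b" using z_min ab by auto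
    then show ?thesis
      unfolding big.R_Suc_desc[OF ab(1)] small.R_Suc_desc[OF ab(1)]
      using Suc.IH ab by (metis less_asym)
  qed
  show ?case
  proof (cases "x \<in> set \<pi>' \<and> w \<in> set \<pi>' \<and> x \<noteq> w")
    case True
    then have "x \<in> set \<pi>" "w \<in> set \<pi>" by auto
    then show ?thesis
      using True Suc.prems desc big.R_total small.R_total big.R_asym small.R_asym
      by (metis linorder_neqE_nat)
  next
    case False
    then have "\<not> ahead \<pi>' (Suc i) x w" using small.R_in_set small.R_irrefl by blast
    moreover have "\<not> ahead \<pi> (Suc i) x w"
      using False Suc.prems big.R_in_set[of "Suc i" x w] big.R_irrefl by auto
    ultimately show ?thesis by simp
  qed
qed

lemma active_remove: "x \<noteq> z \<Longrightarrow> x \<in> active \<pi> i \<longleftrightarrow> x \<in> active \<pi>' i"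
  unfolding active_def using ahead_remove z_pos by simp

lemma active_greater: "x \<in> active \<pi>' i \<Longrightarrow> z < x"
  using z_min small.active_sub by blast

lemma keeper_remove:
  assumes x: "x \<in> active \<pi>' i" shows "keeper \<pi> i x = keeper \<pi>' i x"
proof (rule antisym)
  have zx: "z < x" using active_greater x by blast
  then have xb: "x \<in> active \<pi> i" using active_remove[of x i] x by simp
  have nz: "keeper \<pi> i x \<noteq> z" "keeper \<pi>' i x \<noteq> z"
    using big.keeper_props(4)[OF xb] small.keeper_props(4)[OF x] zx by auto
  show "keeper \<pi> i x \<le> keeper \<pi>' i x"
    using big.keeper_props(1,2)[OF xb] small.keeper_props(3,4)[OF x] active_remove ahead_remove nz zx
    by (metis less_irrefl)
  show "keeper \<pi>' i x \<le> keeper \<pi> i x"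
    using small.keeper_props(1,2)[OF x] big.keeper_props(3,4)[OF xb] active_remove ahead_remove nz zx
    by (metis less_irrefl)
qed

lemma champs_remove: "x \<noteq> z \<Longrightarrow> x \<in> champs \<pi> i \<longleftrightarrow> x \<in> champs \<pi>' i"
  using big.champ_iff small.champ_iff keeper_remove active_remove big.champs_active small.champs_active
  by metis

lemma lab_remove: "x \<in> active \<pi>' i \<Longrightarrow> lab \<pi> i x = lab \<pi>' i x"
proof (induction i arbitrary: x)
  case 0
  have "z < keeper \<pi>' 0 x" using small.keeper_props(4)[OF 0] active_greater[OF 0] by simp
  then have "{c \<in> champs \<pi> 0. keeper \<pi>' 0 x \<le> c} = {c \<in> champs \<pi>' 0. keeper \<pi>' 0 x \<le> c}"
    using champs_remove[of _ 0] by auto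
  then show ?case using keeper_remove[OF 0] by simp
next
  case (Suc i)
  then show ?case
    using keeper_remove small.keeper_props(1) small.active_Suc_sub by simp
qed

lemma small_sub: "x \<in> set \<pi>' - {0} \<Longrightarrow> x \<noteq> z \<and> x \<in> set \<pi> - {0}"
  using z_min by fastforce

lemma tab_remove:
  assumes x: "x \<in> set \<pi>' - {0}" shows "tab \<pi> x = tab \<pi>' x"
proof -
  have c: "x \<in> champs \<pi>' (level \<pi>' x)" using small.level_champ x by blast
  then have "x \<in> champs \<pi> (level \<pi>' x)" using champs_remove small_sub x by blast
  then show ?thesis
    using c lab_remove small.champs_active big.tab_eq small.tab_eq by metis
qed

definition "cells = tab \<pi>' ` (set \<pi>' - {0})"

text \<open>Expresses the old shape through champions of the longer word, so that the label
  inequalities of that word apply to it.\<close>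

lemma cells_eq: "(Suc i, k) \<in> cells \<longleftrightarrow> (\<exists>c \<in> champs \<pi> i. c \<noteq> z \<and> lab \<pi> i c = k)"
proof -
  have "c \<in> champs \<pi>' i \<longleftrightarrow> c \<in> champs \<pi> i \<and> c \<noteq> z" for c
    using champs_remove active_greater small.champs_active by (metis less_irrefl)
  moreover have "lab \<pi> i c = lab \<pi>' i c" if "c \<in> champs \<pi>' i" for c
    using that lab_remove small.champs_active by blast
  ultimately show ?thesis unfolding cells_def small.tab_image by metis
qed

lemma z_in: "z \<in> set \<pi> - {0}"
  using z_pos by simp

lemma z_active: "z \<in> active \<pi> 0"
  using big.active_0 z_in by simp

lemma z_before_y: "ahead \<pi> 0 z y"
  by (simp add: ahead_def prec_append)

text \<open>Directly in front of the final 0, \<open>z\<close> is a champion at once, and the least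
  one, so it starts the row after all existing rows.\<close>

lemma tab_last:
  assumes "y = 0"
  shows "tab \<pi> z = (1, Suc (card {x \<in> set \<pi>' - {0}. fst (tab \<pi>' x) = 1}))"
proof -
  have no: "\<not> ahead \<pi> 0 z x" if "x \<in> active \<pi> 0" for x
  proof
    assume "ahead \<pi> 0 z x"
    then have "x \<in> set (y # vs)"
      using prec_split_iff(2)[OF big.distinct] by (simp add: ahead_def)
    moreover have "x \<noteq> 0" using big.active_sub[OF that] by simp
    ultimately have "x \<in> set vs" using assms by simp
    then have "vs \<noteq> []" by auto
    then have "last \<pi> \<in> set vs" by simp
    then show False using big.last_zero big.distinct assms by auto
  qed
  then have zC: "z \<in> champs \<pi> 0" using z_active by (simp add: champs_def)
  have "z < c \<and> c \<in> champs \<pi> 0" if "c \<in> champs \<pi>' 0" for c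
    using that champs_remove[of c 0] active_greater[of c 0] small.champs_active[of c 0] by auto
  then have "{c \<in> champs \<pi> 0. z \<le> c} = insert z (champs \<pi>' 0)"
    using zC champs_remove[of _ 0] by (auto simp: less_imp_le)
  moreover have "z \<notin> champs \<pi>' 0" using active_greater small.champs_active by blast
  moreover have "champs \<pi>' 0 = {x \<in> set \<pi>' - {0}. fst (tab \<pi>' x) = 1}"
    by (rule small.champs_0_eq)
  ultimately show ?thesis
    using big.tab_eq[OF zC] big.champ_keeper_eq[OF zC] small.finite_champs[of 0] by simp
qed

text \<open>\<open>j1\<close> is the row of the block in which \<open>z\<close> and \<open>y\<close>
  both start. From there \<open>z\<close> passes over the rows up to \<open>\<rho>\<close> and
  \<open>y\<close> over those up to \<open>j\<close>; the passed rows lack a cell in column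
  \<open>e - 1\<close> or \<open>f\<close>, respectively.\<close>

lemma tab_insert:
  assumes "y \<noteq> 0" "tab \<pi> z = (e, \<rho>)" "tab \<pi>' y = (f, j)"
  obtains j1 where "2 \<le> e" "(e - 1, \<rho>) \<in> cells" "(e, \<rho>) \<notin> cells"
    "\<And>k. j1 \<le> k \<Longrightarrow> k < \<rho> \<Longrightarrow> (e - 1, k) \<notin> cells"
    "\<And>k. \<rho> < k \<Longrightarrow> (e, k) \<notin> cells"
    "j1 \<le> j" "j1 \<le> \<rho>"
    "\<And>k. j1 \<le> k \<Longrightarrow> k < j \<Longrightarrow> (f, k) \<notin> cells"
proof -
  define j1 where "j1 = lab \<pi> 0 z"
  have y: "y \<in> set \<pi>' - {0}" "z < y" using assms(1) z_min by auto
  have yb: "y \<in> active \<pi> 0" using y big.active_0 by simp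
  \<comment> \<open>The entries behind \<open>z\<close> are \<open>y\<close> and those behind
    \<open>y\<close>, and \<open>z < y\<close>, so the two maxima agree.\<close>
  have Ky: "keeper \<pi> 0 z = keeper \<pi> 0 y"
  proof -
    have "{x \<in> active \<pi> 0. x = z \<or> ahead \<pi> 0 z x} = insert z {x \<in> active \<pi> 0. x = y \<or> ahead \<pi> 0 y x}"
    proof -
      have "ahead \<pi> 0 z x \<longleftrightarrow> x = y \<or> ahead \<pi> 0 y x" for x
        using prec_split_iff(2)[OF big.distinct, of x] big.distinct
          prec_split_iff(2)[of "us @ [z]" y vs x] by (simp add: ahead_def)
      then show ?thesis using z_active by auto
    qed
    then have "keeper \<pi> 0 z = Max (insert z {x \<in> active \<pi> 0. x = y \<or> ahead \<pi> 0 y x})"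
      by (simp add: keeper_def)
    also have "\<dots> = max z (Max {x \<in> active \<pi> 0. x = y \<or> ahead \<pi> 0 y x})"
      using yb big.finite_active by (intro Max_insert) auto
    also have "\<dots> = max z (keeper \<pi> 0 y)" by (simp add: keeper_def)
    finally show ?thesis using big.keeper_props(4)[OF yb] y(2) by simp
  qed
  then have j1y: "j1 = lab \<pi> 0 y" unfolding j1_def by simp
  define i where "i = level \<pi> z"
  have zC: "z \<in> champs \<pi> i" using big.level_champ z_in by (simp add: i_def)
  \<comment> \<open>The larger entry \<open>y\<close> in front of 0 prevents \<open>z\<close> from
    being a champion at the start.\<close>
  have "i \<noteq> 0"
  proof
    assume "i = 0"
    then have "y < z" using zC yb z_before_y unfolding champs_def by blast
    then show False using y by simp
  qed
  then obtain i' where i': "i = Suc i'" by (cases i) auto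
  have e: "e = Suc (Suc i')" "\<rho> = lab \<pi> (Suc i') z" using assms(2) big.tab_eq zC i' by auto
  have zC': "z \<in> champs \<pi> (Suc i')" using zC i' by simp
  have za: "z \<in> active \<pi> i'" using zC' big.champs_active big.active_Suc_sub by blast
  have \<rho>: "\<rho> = lab \<pi> i' z" using e big.lab_Suc_champ zC' by simp
  define g where "g = level \<pi> y"
  have yC: "y \<in> champs \<pi> g" using big.level_champ y by (simp add: g_def)
  have f: "f = Suc g" "j = lab \<pi> g y" using assms(3) big.tab_eq[OF yC] tab_remove[OF y(1)] by auto
  show ?thesis
  proof (rule that)
    show "2 \<le> e" using e by simp
    \<comment> \<open>The predecessor of \<open>z\<close> in its row is another entry, so its cell
      belongs to the old shape.\<close>
    have "keeper \<pi> i' z \<noteq> z"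
      using big.champ_pred[OF zC'] big.champs_level_unique[of z i' "Suc i'"] zC' by auto
    then show "(e - 1, \<rho>) \<in> cells"
      using big.champ_pred[OF zC'] e by (auto simp: cells_eq)
    show "(e, \<rho>) \<notin> cells" using big.lab_inj[OF _ zC'] e by (auto simp: cells_eq)
    show "(e - 1, k) \<notin> cells" if "j1 \<le> k" "k < \<rho>" for k
      using big.no_champ_passed[OF za] that e \<rho> by (fastforce simp: cells_eq j1_def)
    \<comment> \<open>Every other champion of this level exceeds \<open>z\<close> and therefore has
      a smaller label.\<close>
    show "(e, k) \<notin> cells" if "\<rho> < k" for k
    proof
      assume "(e, k) \<in> cells"
      then obtain c where c: "c \<in> champs \<pi> (Suc i')" "c \<noteq> z" "lab \<pi> (Suc i') c = k"
        using e by (auto simp: cells_eq)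
      then have "z < c" using champs_remove active_greater small.champs_active by blast
      then have "k < \<rho>"
        using big.keeper_less_lab[of c "Suc i'" z] big.champ_keeper_eq big.champs_active c zC' e by auto
      then show False using that by simp
    qed
    show "j1 \<le> j" using big.lab_0_le big.champs_active yC f j1y by auto
    show "j1 \<le> \<rho>" using big.lab_0_le za \<rho> j1_def by auto
    show "(f, k) \<notin> cells" if "j1 \<le> k" "k < j" for k
      using big.no_champ_passed[of y g] big.champs_active[OF yC] that f j1y by (fastforce simp: cells_eq)
  qed
qed

end

section \<open>Shapes as sets of cells (column, row), so that single cells can be removed, and their
  hooks\<close>

definition left_justified :: "(nat \<times> nat) set \<Rightarrow> bool" where
  "left_justified D \<longleftrightarrow> finite D \<and> (\<forall>i j. (i, j) \<in> D \<longrightarrow> 1 \<le> i \<and> 1 \<le> j) \<and>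
     (\<forall>i i' j. (i, j) \<in> D \<longrightarrow> 1 \<le> i' \<longrightarrow> i' \<le> i \<longrightarrow> (i', j) \<in> D) \<and>
     (\<forall>j j'. (1, j) \<in> D \<longrightarrow> 1 \<le> j' \<longrightarrow> j' \<le> j \<longrightarrow> (1, j') \<in> D)"

text \<open>The bound \<open>r\<close> of the hook length is replaced by an equivalent condition:
  \<open>j'\<close> lies beyond every row before \<open>j\<close> that reaches column
  \<open>i - 1\<close> iff none of the rows from \<open>j'\<close> to \<open>j - 1\<close> reaches
  it.\<close>

definition hook_cells :: "(nat \<times> nat) set \<Rightarrow> nat \<Rightarrow> nat \<Rightarrow> (nat \<times> nat) set" where
  "hook_cells D i j = {(i', j') \<in> D. i' < i \<and> j' \<le> j \<and> (\<forall>k. j' \<le> k \<longrightarrow> k < j \<longrightarrow> (i - 1, k) \<notin> D)}"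

definition hook_number :: "(nat \<times> nat) set \<Rightarrow> nat \<Rightarrow> nat \<Rightarrow> nat" where
  "hook_number D i j = (if i = 1 then 1 else card (hook_cells D i j))"

text \<open>\<open>D\<close> is the shape before insertion. Both \<open>(a, b)\<close> and
  \<open>(e, \<rho>)\<close> can extend it: each ends its row, and its column has no cell in a later
  row. Two such cells in different rows are told apart by comparing row lengths.\<close>

lemma new_cell_iff:
  fixes D :: "(nat \<times> nat) set"
  assumes down: "\<And>i i' j. (i, j) \<in> D \<Longrightarrow> 1 \<le> i' \<Longrightarrow> i' \<le> i \<Longrightarrow> (i', j) \<in> D"
    and ab: "2 \<le> a" "(a - 1, b) \<in> D" "(a, b) \<notin> D" "\<And>k. b < k \<Longrightarrow> (a, k) \<notin> D"
    and e: "2 \<le> e" "(e - 1, \<rho>) \<in> D" "(e, \<rho>) \<notin> D" "\<And>k. \<rho> < k \<Longrightarrow> (e, k) \<notin> D"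
    and pass: "\<And>k. j1 \<le> k \<Longrightarrow> k < \<rho> \<Longrightarrow> (e - 1, k) \<notin> D" "j1 \<le> j" "j1 \<le> \<rho>"
      "\<And>k. j1 \<le> k \<Longrightarrow> k < j \<Longrightarrow> (f, k) \<notin> D"
    and f: "(f, j) \<in> D" "1 \<le> f"
  shows "(e, \<rho>) = (a, b) \<longleftrightarrow> f < a \<and> j \<le> b \<and> (\<forall>k. j \<le> k \<longrightarrow> k < b \<longrightarrow> (a - 1, k) \<notin> D)"
proof -
  \<comment> \<open>Otherwise row \<open>\<rho>\<close> is one of the rows passed by
    \<open>y\<close>, so it is shorter than \<open>f\<close>. Then \<open>e \<le> f\<close>, and row
    \<open>j\<close> has a cell in column \<open>e\<close> beyond row \<open>\<rho>\<close>.\<close>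
  have j\<rho>: "j \<le> \<rho>"
  proof (rule ccontr)
    assume "\<not> j \<le> \<rho>"
    then have "\<rho> < j" by simp
    then have "(f, \<rho>) \<notin> D" using pass by blast
    then have "e \<le> f" using down[OF e(2), of f] f(2) by linarith
    then have "(e, j) \<in> D" using down[OF f(1), of e] e(1) by simp
    then show False using e(4) \<open>\<rho> < j\<close> by blast
  qed
  show ?thesis
  proof
    assume eq: "(e, \<rho>) = (a, b)"
    have "f < a"
    proof (rule ccontr)
      assume "\<not> f < a"
      then have "(e, j) \<in> D" "(e - 1, j) \<in> D"
        using eq down[OF f(1), of e] down[OF f(1), of "e - 1"] e(1) by auto
      then show False using j\<rho> e(3) pass(1)[of j] pass(2) by (cases "j = \<rho>") auto
    qed
    then show "f < a \<and> j \<le> b \<and> (\<forall>k. j \<le> k \<longrightarrow> k < b \<longrightarrow> (a - 1, k) \<notin> D)"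
      using eq j\<rho> pass(1,2) by auto
  next
    assume R: "f < a \<and> j \<le> b \<and> (\<forall>k. j \<le> k \<longrightarrow> k < b \<longrightarrow> (a - 1, k) \<notin> D)"
    \<comment> \<open>If \<open>b < \<rho>\<close>, row \<open>b\<close> is passed by
      \<open>z\<close> and is too short, so row \<open>\<rho>\<close> reaches column
      \<open>a\<close> beyond row \<open>b\<close>. The case \<open>\<rho> < b\<close> is symmetric,
      with the hook condition in place of the passing condition.\<close>
    have "\<not> b < \<rho>"
    proof
      assume "b < \<rho>"
      then have "(e - 1, b) \<notin> D" using pass(1,2) R by auto
      then have "a \<le> e - 1" using down[OF ab(2), of "e - 1"] e(1) by linarith
      then have "(a, \<rho>) \<in> D" using down[OF e(2), of a] ab(1) by simp
      then show False using ab(4) \<open>b < \<rho>\<close> by blast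
    qed
    moreover have "\<not> \<rho> < b"
    proof
      assume "\<rho> < b"
      then have "(a - 1, \<rho>) \<notin> D" using R j\<rho> by auto
      then have "e \<le> a - 1" using down[OF e(2), of "a - 1"] ab(1) by linarith
      then have "(e, b) \<in> D" using down[OF ab(2), of e] e(1) by simp
      then show False using e(4) \<open>\<rho> < b\<close> by blast
    qed
    ultimately have "\<rho> = b" by simp
    moreover have "\<not> a \<le> e - 1" using down[OF e(2), of a] ab \<open>\<rho> = b\<close> by auto
    moreover have "\<not> e \<le> a - 1" using down[OF ab(2), of e] e \<open>\<rho> = b\<close> by auto
    ultimately show "(e, \<rho>) = (a, b)" using ab(1) e(1) by auto
  qed
qed

lemma insertion_condition:
  fixes T :: "nat \<Rightarrow> nat \<times> nat"
  assumes lj: "left_justified D" and bij: "bij_betw T (insert z A) D"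
    and A: "0 \<notin> insert z A" "\<And>a. a \<in> A \<Longrightarrow> z < a"
    and ord: "\<And>x w. x \<in> insert z A \<Longrightarrow> w \<in> insert z A \<Longrightarrow> ge_D (T x) (T w) \<Longrightarrow> w \<le> x"
    and word: "distinct (us @ z # y # vs)" "set (us @ y # vs) = insert 0 A" "last (us @ y # vs) = 0"
    and tab: "\<And>x. x \<in> A \<Longrightarrow> tab (us @ y # vs) x = T x"
    and Tz: "T z = (a, b)"
  shows "tab (us @ z # y # vs) z = (a, b) \<longleftrightarrow>
    y \<in> (if a = 1 then {0} else {y \<in> A. T y \<in> hook_cells D a b})"
proof -
  interpret min_inserted us vs z y
  proof unfold_locales
    show "z \<noteq> 0" using A by auto
    show "z < x" if "x \<in> set (us @ y # vs)" "x \<noteq> 0" for x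
      using that A(2)[of x] unfolding word(2) by blast
  qed (use word in auto)
  have A': "set (us @ y # vs) - {0} = A" unfolding word(2) using A(1) by auto
  have zA: "z \<notin> A" using A(2) by blast
  have D: "D = T ` insert z A" and inj: "inj_on T (insert z A)"
    using bij by (auto simp: bij_betw_def)
  have cells: "cells = D - {(a, b)}"
  proof -
    have "cells = T ` A" unfolding cells_def A' using tab by (rule image_cong[OF refl])
    also have "\<dots> = T ` insert z A - T ` {z}" using inj zA
      by (subst inj_on_image_set_diff[symmetric, OF inj]) auto
    finally show ?thesis using D Tz by simp
  qed
  \<comment> \<open>\<open>T\<close> reverses the order of cells and \<open>z\<close> is the least
    entry, so no other cell is weakly beyond its cell in both coordinates.\<close>
  have corner: "(i, j) = (a, b)" if ij: "(i, j) \<in> D" "a \<le> i" "b \<le> j" for i j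
  proof -
    obtain x where x: "x \<in> insert z A" "T x = (i, j)" using ij(1) D by force
    then have "x \<le> z" using ord[of z x] Tz ij by (simp add: ge_D_def)
    then have "x = z" using x A(2) by force
    then show ?thesis using x Tz by simp
  qed
  have abD: "(a, b) \<in> D" using D Tz by force
  have pos: "1 \<le> i" "1 \<le> j" if "(i, j) \<in> D" for i j
    using lj that unfolding left_justified_def by blast+
  have down: "(i', j) \<in> D" if "(i, j) \<in> D" "1 \<le> i'" "i' \<le> i" for i i' j
    using lj that unfolding left_justified_def by blast
  show ?thesis
  proof (cases "y = 0")
    case True
    note last = tab_last[OF True, unfolded A']
    show ?thesis
    proof (cases "a = 1")
      case a: True
      \<comment> \<open>Before the insertion the first column consists of the rows 1 to
        \<open>b - 1\<close>, so the new row of \<open>tab_last\<close> has number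
        \<open>b\<close>.\<close>
      have "T ` {x \<in> A. fst (T x) = 1} = Pair 1 ` {1..<b}"
      proof -
        have "T ` {x \<in> A. fst (T x) = 1} = {p \<in> T ` A. fst p = 1}" by auto
        also have "T ` A = D - {(1, b)}"
          using cells a tab unfolding cells_def A' by (metis image_cong)
        also have "{p \<in> D - {(1, b)}. fst p = 1} = Pair 1 ` {1..<b}"
        proof (intro equalityI subsetI)
          fix p assume "p \<in> {p \<in> D - {(1, b)}. fst p = 1}"
          then obtain k where k: "p = (1, k)" "(1, k) \<in> D" "k \<noteq> b" by (cases p) auto
          then have "k < b" using corner[of 1 k] a by (meson leI order_refl prod.inject)
          then show "p \<in> Pair 1 ` {1..<b}" using k pos by auto
        next
          fix p :: "nat \<times> nat" assume "p \<in> Pair 1 ` {1..<b}"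
          then obtain k where k: "p = (1, k)" "1 \<le> k" "k < b" by auto
          moreover have "(1, k) \<in> D"
            using lj abD a k unfolding left_justified_def by (meson less_imp_le)
          ultimately show "p \<in> {p \<in> D - {(1, b)}. fst p = 1}" by auto
        qed
        finally show ?thesis .
      qed
      moreover have "card (T ` {x \<in> A. fst (T x) = 1}) = card {x \<in> A. fst (T x) = 1}"
        by (rule card_image, rule inj_on_subset[OF inj]) auto
      moreover have "card (Pair (1::nat) ` {1..<b}) = b - 1"
        by (subst card_image) (auto simp: inj_on_def)
      moreover have "{x \<in> A. fst (tab (us @ y # vs) x) = 1} = {x \<in> A. fst (T x) = 1}"
        using tab by auto
      ultimately show ?thesis using last a True pos[OF abD] by simp
    next
      case False
      then show ?thesis using last True A(1) by auto
    qed
  next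
    case False
    moreover have "y \<in> set (us @ y # vs)" by simp
    ultimately have yA: "y \<in> A" unfolding word(2) by blast
    obtain f j where fj: "T y = (f, j)" by (cases "T y")
    then have fj': "tab (us @ y # vs) y = (f, j)" using tab yA by simp
    obtain e \<rho> where e: "tab (us @ z # y # vs) z = (e, \<rho>)" by fastforce
    have fjc: "(f, j) \<in> cells" using fj' yA unfolding cells_def A' by force
    show ?thesis
    proof (rule tab_insert[OF False e fj'])
      fix j1
      assume *: "2 \<le> e" "(e - 1, \<rho>) \<in> cells" "(e, \<rho>) \<notin> cells"
        "\<And>k. j1 \<le> k \<Longrightarrow> k < \<rho> \<Longrightarrow> (e - 1, k) \<notin> cells"
        "\<And>k. \<rho> < k \<Longrightarrow> (e, k) \<notin> cells" "j1 \<le> j" "j1 \<le> \<rho>"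
        "\<And>k. j1 \<le> k \<Longrightarrow> k < j \<Longrightarrow> (f, k) \<notin> cells"
      show ?thesis
      proof (cases "a = 1")
        case True
        then show ?thesis using e *(1) False by auto
      next
        case a: False
        then have a2: "2 \<le> a" using pos[OF abD] by simp
        have "(e, \<rho>) = (a, b) \<longleftrightarrow> f < a \<and> j \<le> b \<and> (\<forall>k. j \<le> k \<longrightarrow> k < b \<longrightarrow> (a - 1, k) \<notin> cells)"
        proof (rule new_cell_iff[OF _ a2 _ _ _ *(1-3) *(5) *(4) *(6-8) fjc])
          show "(i', j) \<in> cells" if "(i, j) \<in> cells" "1 \<le> i'" "i' \<le> i" for i i' j
            using that down[of i j i'] corner[of i j] unfolding cells by auto
          show "(a - 1, b) \<in> cells" using down[OF abD, of "a - 1"] a2 unfolding cells by auto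
          show "(a, b) \<notin> cells" unfolding cells by simp
          show "(a, k) \<notin> cells" if "b < k" for k
            using corner[of a k] that unfolding cells by auto
          show "1 \<le> f" using fjc pos unfolding cells by blast
        qed
        \<comment> \<open>The old and the new shape differ only in column \<open>a\<close>, and the
          hook condition looks at column \<open>a - 1\<close>.\<close>
        moreover have "(a - 1, k) \<in> cells \<longleftrightarrow> (a - 1, k) \<in> D" for k
          using a2 unfolding cells by auto
        moreover have "(f, j) \<in> D" using fjc cells by blast
        ultimately show ?thesis using e a fj yA by (simp add: hook_cells_def)
      qed
    qed
  qed
qed

section \<open>Counting\<close>

definition tableau_words :: "nat set \<Rightarrow> (nat \<Rightarrow> nat \<times> nat) \<Rightarrow> nat list set" where
  "tableau_words A T = {\<pi>. distinct \<pi> \<and> set \<pi> = insert 0 A \<and> last \<pi> = 0 \<and> (\<forall>x \<in> A. tab \<pi> x = T x)}"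

text \<open>A word containing \<open>z\<close> is the same as a word without it together with the
  right neighbour of \<open>z\<close>. By \<open>insertion_condition\<close> the admissible
  neighbours form \<open>Y\<close>, whatever the word, and \<open>T\<close> matches them with the
  hook cells when \<open>a\<close> is not 1.\<close>

lemma card_tableau_words_insert:
  fixes T :: "nat \<Rightarrow> nat \<times> nat"
  assumes lj: "left_justified D" and bij: "bij_betw T (insert z A) D"
    and A: "finite A" "0 \<notin> insert z A" "\<And>a. a \<in> A \<Longrightarrow> z < a"
    and ord: "\<And>x w. x \<in> insert z A \<Longrightarrow> w \<in> insert z A \<Longrightarrow> ge_D (T x) (T w) \<Longrightarrow> w \<le> x"
    and Tz: "T z = (a, b)"
  shows "card (tableau_words (insert z A) T) = card (tableau_words A T) * hook_number D a b"
proof -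
  define Y where "Y = (if a = 1 then {0} else {y \<in> A. T y \<in> hook_cells D a b})"
  define ins where "ins = (\<lambda>(\<pi>, y). before y \<pi> @ z # y # after y \<pi>)"
  have zA: "z \<notin> A" using A(3) by blast
  have D: "D = T ` insert z A" and inj: "inj_on T (insert z A)"
    using bij by (auto simp: bij_betw_def)
  have YA: "Y \<subseteq> insert 0 A" unfolding Y_def by auto
  have cardY: "card Y = hook_number D a b"
  proof (cases "a = 1")
    case False
    have "T ` Y = hook_cells D a b"
    proof (intro equalityI subsetI)
      fix p assume p: "p \<in> hook_cells D a b"
      then have "p \<in> D" "p \<noteq> (a, b)" by (auto simp: hook_cells_def)
      then obtain x where "x \<in> A" "T x = p" using D Tz by auto
      then show "p \<in> T ` Y" using p False by (auto simp: Y_def)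
    qed (use False Y_def in auto)
    moreover have "inj_on T Y"
      by (rule inj_on_subset[OF inj]) (use False in \<open>auto simp: Y_def\<close>)
    ultimately show ?thesis using False card_image[of T Y] by (simp add: hook_number_def)
  qed (simp add: Y_def hook_number_def)
  have split: "before y \<pi> @ y # after y \<pi> = \<pi>" if "y \<in> set \<pi>" for y :: nat and \<pi>
    using that split_list_first[of y \<pi>] before_after_split by metis
  have mem: "us @ z # y # vs \<in> tableau_words (insert z A) T \<longleftrightarrow> us @ y # vs \<in> tableau_words A T \<and> y \<in> Y"
    if word: "distinct (us @ z # y # vs)" "set (us @ y # vs) = insert 0 A" "last (us @ y # vs) = 0"
    for us y vs
  proof -
    interpret min_inserted us vs z y
    proof unfold_locales
      show "z \<noteq> 0" using A by auto
      show "z < x" if "x \<in> set (us @ y # vs)" "x \<noteq> 0" for x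
        using that A(3)[of x] unfolding word(2) by blast
    qed (use word in auto)
    have A': "set (us @ y # vs) - {0} = A" unfolding word(2) using A(2) by auto
    have "(\<forall>x \<in> A. tab (us @ z # y # vs) x = T x) \<longleftrightarrow> (\<forall>x \<in> A. tab (us @ y # vs) x = T x)"
      using tab_remove unfolding A' by auto
    moreover have "tab (us @ z # y # vs) z = T z \<longleftrightarrow> y \<in> Y"
      if "\<forall>x \<in> A. tab (us @ y # vs) x = T x"
      unfolding Y_def Tz
      by (rule insertion_condition[OF lj bij A(2,3) ord word _ Tz]) (use that in auto)
    moreover have "set (us @ z # y # vs) = insert z (set (us @ y # vs))" by auto
    then have "set (us @ z # y # vs) = insert 0 (insert z A)" unfolding word(2) by auto
    moreover have "last (us @ z # y # vs) = 0" using word(3) by simp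
    moreover have "distinct (us @ y # vs)" using word(1) by auto
    ultimately show ?thesis using word unfolding tableau_words_def by blast
  qed
  have "bij_betw ins (tableau_words A T \<times> Y) (tableau_words (insert z A) T)"
  proof (rule bij_betw_imageI)
    show "inj_on ins (tableau_words A T \<times> Y)"
    proof (rule inj_onI, clarify)
      fix \<pi> y \<pi>' y'
      assume p: "\<pi> \<in> tableau_words A T" "y \<in> Y" "\<pi>' \<in> tableau_words A T" "y' \<in> Y"
        and eq: "ins (\<pi>, y) = ins (\<pi>', y')"
      have in_set: "y \<in> set \<pi>" "y' \<in> set \<pi>'" "z \<notin> set \<pi>" "z \<notin> set \<pi>'"
        using p YA zA A(2) by (auto simp: tableau_words_def)
      \<comment> \<open>As \<open>z\<close> occurs in neither word, its position in the result
        determines what lies on either side.\<close>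
      then have "z \<notin> set (before y \<pi>)" "z \<notin> set (before y' \<pi>')"
        by (auto simp: before_def dest: set_takeWhileD)
      then have "before y \<pi> = before y' \<pi>' \<and> y # after y \<pi> = y' # after y' \<pi>'"
        using eq before_after_split unfolding ins_def split_beta fst_conv snd_conv by metis
      then show "\<pi> = \<pi>' \<and> y = y'" using split in_set by (metis list.inject)
    qed
    show "ins ` (tableau_words A T \<times> Y) = tableau_words (insert z A) T"
    proof (intro equalityI subsetI)
      fix w assume "w \<in> ins ` (tableau_words A T \<times> Y)"
      then obtain \<pi> y where p: "\<pi> \<in> tableau_words A T" "y \<in> Y" "w = ins (\<pi>, y)" by auto
      then have y: "y \<in> set \<pi>" using YA by (auto simp: tableau_words_def)
      have d: "distinct (before y \<pi> @ y # after y \<pi>)"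
        "set (before y \<pi> @ y # after y \<pi>) = insert 0 A" "last (before y \<pi> @ y # after y \<pi>) = 0"
        "before y \<pi> @ y # after y \<pi> \<in> tableau_words A T"
        using p unfolding split[OF y] by (auto simp: tableau_words_def)
      have "z \<notin> insert 0 A" using zA A(2) by auto
      then have "distinct (before y \<pi> @ z # y # after y \<pi>)" using d(1,2) by auto
      then show "w \<in> tableau_words (insert z A) T"
        using mem[of "before y \<pi>" y "after y \<pi>"] d p by (simp add: ins_def)
    next
      fix w assume w: "w \<in> tableau_words (insert z A) T"
      then have "z \<in> set w" by (auto simp: tableau_words_def)
      then obtain us vs' where "w = us @ z # vs'" by (meson split_list)
      \<comment> \<open>The last letter is 0 and \<open>z\<close> is positive, so \<open>z\<close>
        has a right neighbour.\<close>
      moreover have "vs' \<noteq> []" using w A(2) calculation by (auto simp: tableau_words_def)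
      ultimately obtain y vs where wv: "w = us @ z # y # vs" by (cases vs') auto
      have d: "distinct (us @ z # y # vs)" and s: "set (us @ z # y # vs) = insert 0 (insert z A)"
        and l: "last (us @ y # vs) = 0"
        using w unfolding wv tableau_words_def by auto
      have "set (us @ y # vs) = set (us @ z # y # vs) - {z}" using d by auto
      then have s': "set (us @ y # vs) = insert 0 A" unfolding s using zA A(2) by auto
      have "us @ y # vs \<in> tableau_words A T" "y \<in> Y"
        using mem[OF d s' l] w wv by auto
      moreover have "ins (us @ y # vs, y) = w"
        using before_after_split[of y us vs] d unfolding wv ins_def by auto
      ultimately show "w \<in> ins ` (tableau_words A T \<times> Y)" by force
    qed
  qed
  then show ?thesis
    using bij_betw_same_card card_cartesian_product cardY by metis
qed

text \<open>Entries are added in decreasing order. The cell of the new least entry is a corner, so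
  the remaining cells form a left-justified shape and the product gains a single factor.\<close>

lemma card_tableau_words:
  fixes T :: "nat \<Rightarrow> nat \<times> nat"
  assumes "finite A" "0 \<notin> A" "left_justified D" "bij_betw T A D"
    and "\<And>x w. x \<in> A \<Longrightarrow> w \<in> A \<Longrightarrow> ge_D (T x) (T w) \<Longrightarrow> w \<le> x"
  shows "card (tableau_words A T) = (\<Prod>(i, j) \<in> D. hook_number D i j)"
  using assms
proof (induction A arbitrary: D rule: finite_linorder_min_induct)
  case empty
  then have "D = {}" by (simp add: bij_betw_def)
  moreover have "tableau_words {} T = {[0]}"
  proof -
    have "\<pi> = [0]" if "distinct \<pi>" "set \<pi> = {0}" for \<pi> :: "nat list"
      using that by (cases \<pi>) (auto simp: subset_singleton_iff)
    then show ?thesis by (auto simp: tableau_words_def)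
  qed
  ultimately show ?case by simp
next
  case (insert z A)
  obtain a b where Tz: "T z = (a, b)" by fastforce
  define D' where "D' = D - {(a, b)}"
  have D: "D = T ` insert z A" and inj: "inj_on T (insert z A)"
    using insert.prems(3) by (auto simp: bij_betw_def)
  have zA: "z \<notin> A" using insert.hyps by blast
  have abD: "(a, b) \<in> D" using D Tz by force
  have corner: "(i, j) = (a, b)" if ij: "(i, j) \<in> D" "a \<le> i" "b \<le> j" for i j
  proof -
    obtain x where x: "x \<in> insert z A" "T x = (i, j)" using ij(1) D by force
    then have "x \<le> z" using insert.prems(4)[of z x] Tz ij by (simp add: ge_D_def)
    then have "x = z" using x insert.hyps(2) by force
    then show ?thesis using x Tz by simp
  qed
  have fin: "finite D" using insert.prems(2) by (simp add: left_justified_def)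
  have lj': "left_justified D'"
    unfolding left_justified_def
  proof (intro conjI allI impI)
    show "finite D'" using fin by (simp add: D'_def)
    fix i j assume ij: "(i, j) \<in> D'"
    then show "1 \<le> i" "1 \<le> j"
      using insert.prems(2) unfolding left_justified_def D'_def by blast+
    fix i' assume i': "1 \<le> i'" "i' \<le> i"
    then have "(i', j) \<in> D"
      using insert.prems(2) ij unfolding left_justified_def D'_def by blast
    then show "(i', j) \<in> D'" using corner[of i j] ij i' by (auto simp: D'_def)
  next
    fix j j' assume j: "(1, j) \<in> D'" "1 \<le> j'" "j' \<le> j"
    then have "(1, j') \<in> D"
      using insert.prems(2) unfolding left_justified_def D'_def by blast
    then show "(1, j') \<in> D'" using corner[of 1 j] j by (auto simp: D'_def)
  qed
  have "T ` A = D'" unfolding D'_def D using inj zA Tz by (auto simp: inj_on_def)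
  then have bij': "bij_betw T A D'" using inj by (auto simp: bij_betw_def)
  \<comment> \<open>A hook involves only cells with smaller column and no larger row; the removed
    corner among them would force \<open>(i, j) = (a, b)\<close>.\<close>
  have hook: "hook_number D' i j = hook_number D i j" if ij: "(i, j) \<in> D'" for i j
  proof -
    have no: "\<not> (a \<le> i \<and> b \<le> j)" using corner[of i j] ij by (auto simp: D'_def)
    have "(\<forall>k. j' \<le> k \<longrightarrow> k < j \<longrightarrow> (i - 1, k) \<notin> D') \<longleftrightarrow>
        (\<forall>k. j' \<le> k \<longrightarrow> k < j \<longrightarrow> (i - 1, k) \<notin> D)" for j'
      using no by (auto simp: D'_def)
    moreover have "(i', j') \<in> D' \<longleftrightarrow> (i', j') \<in> D" if "i' < i" "j' \<le> j" for i' j'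
      using no that by (auto simp: D'_def)
    ultimately have "hook_cells D' i j = hook_cells D i j"
      unfolding hook_cells_def by blast
    then show ?thesis by (simp add: hook_number_def)
  qed
  have "card (tableau_words A T) = (\<Prod>(i, j) \<in> D'. hook_number D' i j)"
    using insert.IH[OF _ lj' bij'] insert.prems(1,4) by auto
  also have "\<dots> = (\<Prod>(i, j) \<in> D'. hook_number D i j)"
    using hook by (intro prod.cong) auto
  finally have "card (tableau_words (insert z A) T) =
      (\<Prod>(i, j) \<in> D'. hook_number D i j) * hook_number D a b"
    using card_tableau_words_insert[OF insert.prems(2,3) insert.hyps(1) insert.prems(1) _
      insert.prems(4) Tz] insert.hyps(2) by simp
  also have "\<dots> = (\<Prod>(i, j) \<in> D. hook_number D i j)"
    unfolding D'_def using prod.remove[OF fin abD, of "\<lambda>(i, j). hook_number D i j"] by simp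
  finally show ?case .
qed

section \<open>Diagrams of compositions and their hook lengths\<close>

lemma left_justified_diagram:
  assumes "finite (diagram \<alpha>)" "\<forall>a \<in> set \<alpha>. a \<ge> 1"
  shows "left_justified (diagram \<alpha>)"
  unfolding left_justified_def
proof (intro conjI allI impI)
  fix j j' assume "(1, j) \<in> diagram \<alpha>" "1 \<le> j'" "j' \<le> j"
  then have "1 \<le> j'" "j' \<le> length \<alpha>" by (auto simp: diagram_def)
  moreover from this have "\<alpha> ! (j' - 1) \<in> set \<alpha>" by (intro nth_mem) auto
  ultimately show "(1, j') \<in> diagram \<alpha>" using assms(2) by (auto simp: diagram_def)
qed (use assms(1) in \<open>auto simp: diagram_def\<close>)

lemma hook_eq_hook_number:
  assumes ij: "(i, j) \<in> diagram \<alpha>"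
  shows "hook \<alpha> i j = hook_number (diagram \<alpha>) i j"
proof (cases "i = 1")
  case False
  define R where "R = {j'. 1 \<le> j' \<and> j' < j \<and> \<alpha> ! (j' - 1) \<ge> i - 1}"
  have R: "k \<in> R \<longleftrightarrow> k < j \<and> (i - 1, k) \<in> diagram \<alpha>" for k
    using ij False by (auto simp: R_def diagram_def)
  have fin: "finite R" by (rule finite_subset[of _ "{..<j}"]) (auto simp: R_def)
  \<comment> \<open>The default bound 0 for empty \<open>R\<close> agrees with the universal
    condition because rows start at 1.\<close>
  have bound: "hook_bound \<alpha> i j < j' \<longleftrightarrow> (\<forall>k. j' \<le> k \<longrightarrow> k < j \<longrightarrow> (i - 1, k) \<notin> diagram \<alpha>)"
    if "1 \<le> j'" for j'
  proof -
    have "hook_bound \<alpha> i j < j' \<longleftrightarrow> (\<forall>k \<in> R. k < j')"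
      unfolding hook_bound_def R_def[symmetric] Let_def using that fin by auto
    then show ?thesis unfolding Ball_def R by (meson not_le)
  qed
  have "{(i', j') \<in> diagram \<alpha>. i' \<le> i - 1 \<and> hook_bound \<alpha> i j < j' \<and> j' \<le> j} =
      hook_cells (diagram \<alpha>) i j"
  proof -
    have "i' \<le> i - 1 \<and> hook_bound \<alpha> i j < j' \<and> j' \<le> j \<longleftrightarrow>
      i' < i \<and> j' \<le> j \<and> (\<forall>k. j' \<le> k \<longrightarrow> k < j \<longrightarrow> (i - 1, k) \<notin> diagram \<alpha>)"
      if "(i', j') \<in> diagram \<alpha>" for i' j'
    proof -
      have "1 \<le> j'" using that by (simp add: diagram_def)
      moreover have "i' \<le> i - 1 \<longleftrightarrow> i' < i" using ij by (auto simp: diagram_def)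
      ultimately show ?thesis using bound by blast
    qed
    then show ?thesis unfolding hook_cells_def by blast
  qed
  then show ?thesis using False by (simp add: hook_def hook_number_def)
qed (simp add: hook_def hook_number_def)

text \<open>The image of \<open>T\<close> fixes the shape: the first column of the diagram counts
  the rows, and the cells in each row count its entries.\<close>

lemma alpha_eq_if_T_of_eq:
  assumes comp: "\<forall>a \<in> set \<alpha>. a \<ge> 1" and bij: "bij_betw T {1..n} (diagram \<alpha>)"
    and \<pi>: "distinct \<pi>" "set \<pi> = {0..n}" "last \<pi> = 0"
    and T: "\<forall>x \<in> {1..n}. T_of \<pi> x = T x"
  shows "alpha \<pi> = \<alpha>"
proof -
  have "\<pi> \<noteq> []" using \<pi>(2) by force
  then interpret zero_ended \<pi> using \<pi>(1,3) by unfold_locales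
  have set: "set \<pi> - {0} = {1..n}"
    unfolding \<pi>(2) by (intro set_eqI) (simp, arith)
  have len: "length \<pi> - 1 = n" using distinct_card[OF \<pi>(1)] \<pi>(2) by simp
  have inj: "inj_on T {1..n}" and im: "T ` {1..n} = diagram \<alpha>" using bij by (auto simp: bij_betw_def)
  have count: "card {x \<in> {1..n}. P (T x)} = card {p \<in> diagram \<alpha>. P p}" for P
  proof -
    have "T ` {x \<in> {1..n}. P (T x)} = {p \<in> diagram \<alpha>. P p}" unfolding im[symmetric] by auto
    moreover have "inj_on T {x \<in> {1..n}. P (T x)}" by (rule inj_on_subset[OF inj]) auto
    ultimately show ?thesis using card_image by metis
  qed
  have tab: "tab \<pi> x = T x" if "x \<in> {1..n}" for x
    using T_of_eq_tab[of x] T that unfolding set by auto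
  have "length (C_seq \<pi> 1) = card {x \<in> {1..n}. fst (T x) = 1}"
    unfolding length_C_seq_1 set by (rule arg_cong[where f = card]) (use tab in auto)
  also have "\<dots> = card {p \<in> diagram \<alpha>. fst p = 1}" by (rule count)
  also have "{p \<in> diagram \<alpha>. fst p = 1} = Pair 1 ` {1..length \<alpha>}"
    using comp by (auto simp: diagram_def)
  also have "card \<dots> = length \<alpha>" by (subst card_image) (auto simp: inj_on_def)
  finally have l: "length (C_seq \<pi> 1) = length \<alpha>" .
  have r: "card {x \<in> {1..length \<pi> - 1}. row \<pi> x = Suc j} = \<alpha> ! j" if "j < length \<alpha>" for j
  proof -
    have "row \<pi> x = snd (T x)" if "x \<in> {1..n}" for x
      using T that by (metis T_of_def snd_conv)
    then have "{x \<in> {1..length \<pi> - 1}. row \<pi> x = Suc j} = {x \<in> {1..n}. snd (T x) = Suc j}"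
      unfolding len by auto
    also have "card \<dots> = card {p \<in> diagram \<alpha>. snd p = Suc j}" by (rule count)
    also have "{p \<in> diagram \<alpha>. snd p = Suc j} = (\<lambda>i. (i, Suc j)) ` {1..\<alpha> ! j}"
      using that by (auto simp: diagram_def)
    also have "card \<dots> = \<alpha> ! j" by (subst card_image) (auto simp: inj_on_def)
    finally show ?thesis .
  qed
  show ?thesis
  proof (rule nth_equalityI)
    show len': "length (alpha \<pi>) = length \<alpha>"
      unfolding alpha_def l by (simp del: upt_Suc)
    fix j assume "j < length (alpha \<pi>)"
    then have j: "j < length \<alpha>" unfolding len' .
    then have "[1..<length \<alpha> + 1] ! j = Suc j" by (subst nth_upt) auto
    moreover have "j < length [1..<length \<alpha> + 1]" using j by (simp del: upt_Suc)
    ultimately show "alpha \<pi> ! j = \<alpha> ! j"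
      unfolding alpha_def l using r[OF j] by (simp only: nth_map)
  qed
qed

theorem theorem4p10:
  fixes n :: nat and \<alpha> :: "nat list" and T :: "nat \<Rightarrow> nat \<times> nat"
  assumes "composition_of \<alpha> n"
    and "linear_extension n \<alpha> T"
  shows "card {\<pi> \<in> S' n. alpha \<pi> = \<alpha> \<and> (\<forall>x \<in> {1..n}. T_of \<pi> x = T x)}
    = (\<Prod>(i, j) \<in> diagram \<alpha>. hook \<alpha> i j)"
proof -
  have comp: "\<forall>a \<in> set \<alpha>. a \<ge> 1" using assms(1) by (simp add: composition_of_def)
  have bij: "bij_betw T {1..n} (diagram \<alpha>)"
    and ord: "\<And>x w. x \<in> {1..n} \<Longrightarrow> w \<in> {1..n} \<Longrightarrow> ge_D (T x) (T w) \<Longrightarrow> w \<le> x"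
    using assms(2) unfolding linear_extension_def by blast+
  have fin: "finite (diagram \<alpha>)" using bij bij_betw_finite by blast
  have eq: "T_of \<pi> x = tab \<pi> x" if "distinct \<pi>" "set \<pi> = insert 0 {1..n}" "last \<pi> = 0" "x \<in> {1..n}" for \<pi> x
  proof -
    have "\<pi> \<noteq> []" using that(2) by force
    then interpret zero_ended \<pi> using that(1,3) by unfold_locales
    have "x \<in> set \<pi> - {0}" unfolding that(2) using that(4) by simp
    then show ?thesis by (rule T_of_eq_tab)
  qed
  have ins: "{0..n} = insert 0 {1..n}" by auto
  \<comment> \<open>On these words \<open>T_of\<close> agrees with \<open>tab\<close>, and the
    composition is recovered from \<open>T\<close>, so both descriptions select the same
    words.\<close>
  have "{\<pi> \<in> S' n. alpha \<pi> = \<alpha> \<and> (\<forall>x \<in> {1..n}. T_of \<pi> x = T x)} = tableau_words {1..n} T"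
  proof (intro equalityI subsetI)
    fix \<pi> assume "\<pi> \<in> {\<pi> \<in> S' n. alpha \<pi> = \<alpha> \<and> (\<forall>x \<in> {1..n}. T_of \<pi> x = T x)}"
    then show "\<pi> \<in> tableau_words {1..n} T"
      using eq[of \<pi>] unfolding tableau_words_def S'_def permutations_of_set_def ins by auto
  next
    fix \<pi> assume p: "\<pi> \<in> tableau_words {1..n} T"
    then have d: "distinct \<pi>" "set \<pi> = insert 0 {1..n}" "last \<pi> = 0"
      and T: "\<forall>x \<in> {1..n}. T_of \<pi> x = T x"
      using eq[of \<pi>] unfolding tableau_words_def by auto
    then have "alpha \<pi> = \<alpha>" using alpha_eq_if_T_of_eq[OF comp bij, of \<pi>] ins by simp
    then show "\<pi> \<in> {\<pi> \<in> S' n. alpha \<pi> = \<alpha> \<and> (\<forall>x \<in> {1..n}. T_of \<pi> x = T x)}"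
      using d T unfolding S'_def permutations_of_set_def ins by auto
  qed
  also have "card (tableau_words {1..n} T) = (\<Prod>(i, j) \<in> diagram \<alpha>. hook_number (diagram \<alpha>) i j)"
    using card_tableau_words[OF _ _ left_justified_diagram[OF fin comp] bij ord] by simp
  also have "\<dots> = (\<Prod>(i, j) \<in> diagram \<alpha>. hook \<alpha> i j)"
    using hook_eq_hook_number by (intro prod.cong) auto
  finally show ?thesis .
qed

end
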